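(* Let $N$ be a $4$-dimensional neutral space form with constant sectional curvature $L_0$, $M$ a Lorentz surface and $F:M\rightarrow N$ a time-like and conformal immersion with zero mean curvature vector. Let $\check{w}=u+jv$ be a local paracomplex coordinate of $M$, and let $\mu_1,\mu_2$ be the functions of $(u,v)$ representing the normal connection of $F$ with respect to a normal frame $N_1,N_2$ as in the context. If the curvature $K$ of the induced metric satisfies $K\equiv L_0$, then $(\mu_1)_v\equiv(\mu_2)_u$.
   Context: All objects are smooth. Paracomplex numbers: $a+jb$ with $a,b\in\mathbb{R}$, $j^2=1$; conjugate $a-jb$. Space form: $N$ has neutral metric $h$ (signature $(2,2)$) and is taken to be $E^4_2$ if $L_0=0$, $\{x\in E^5_2 : \langle x,x\rangle =1/L_0\}$ if $L_0>0$, $\{x\in E^5_3 : \langle x,x\rangle =1/L_0\}$ if $L_0<0$, where $E^m_k$ is the $m$-dimensional pseudo-Euclidean space of index $k$ (i.e. $k$ minus signs). Lorentz surface: a surface $M$ with an atlas of compatible local paracomplex coordinates $\check{w}=u+jv$. "$F$ time-like and conformal" means that the induced metric is $g=F^*h=e^{2\lambda}d\check{w}\,d\overline{\check{w}}=e^{2\lambda}(du^2-dv^2)$ for a real-valued function $\lambda$ in each such coordinate. Frame: $T_1=dF(\partial_u)$, $T_2=dF(\partial_v)$, and $N_1,N_2$ are local normal vector fields of $F$ with $h(N_1,N_1)=-h(N_2,N_2)=e^{2\lambda}$, $h(N_1,N_2)=0$. With $\nabla^{\perp}$ the normal connection of $F$, the real functions $\mu_1,\mu_2$ are defined by $$\nabla^{\perp}_{T_1}N_1=\lambda_uN_1+\mu_1N_2,\quad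 \nabla^{\perp}_{T_1}N_2=\mu_1N_1+\lambda_uN_2,\quad \nabla^{\perp}_{T_2}N_1=\lambda_vN_1+\mu_2N_2,\quad \nabla^{\perp}_{T_2}N_2=\mu_2N_1+\lambda_vN_2.$$ Subscripts $u,v$ denote partial derivatives. (The condition $(\mu_1)_v\equiv(\mu_2)_u$ is equivalent to flatness of $\nabla^\perp$.) *)

theory Defs
  imports "HOL-Analysis.Analysis"
begin

section \<open>Calculus on open subsets of the coordinate plane\<close>

fun Ck_on :: "nat \<Rightarrow> 'a::real_normed_vector set \<Rightarrow> ('a \<Rightarrow> 'b::real_normed_vector) \<Rightarrow> bool" where
  "Ck_on 0 D f \<longleftrightarrow> continuous_on D f"
| "Ck_on (Suc k) D f \<longleftrightarrow> (\<forall>p\<in>D. f differentiable (at p)) \<and>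
     (\<forall>w. Ck_on k D (\<lambda>p. frechet_derivative f (at p) w))"

text \<open>Only used for open \<open>D\<close>, so that derivatives at points of \<open>D\<close> do not depend on the
  values of \<open>f\<close> off \<open>D\<close>.\<close>

definition smooth_on :: "'a::real_normed_vector set \<Rightarrow> ('a \<Rightarrow> 'b::real_normed_vector) \<Rightarrow> bool" where
  "smooth_on D f \<longleftrightarrow> (\<forall>k. Ck_on k D f)"

text \<open>A point \<open>p :: real^2\<close> has coordinates \<open>u = p $ 1\<close> and \<open>v = p $ 2\<close>, so \<open>pd 1\<close> and \<open>pd 2\<close>
  are the partial derivatives by \<open>u\<close> and \<open>v\<close>.\<close>

definition pd :: "2 \<Rightarrow> (real^2 \<Rightarrow> 'b::real_normed_vector) \<Rightarrow> real^2 \<Rightarrow> 'b" where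
  "pd i f p = frechet_derivative f (at p) (axis i 1)"

section \<open>Lorentz surfaces\<close>

text \<open>The paracomplex number \<open>a + jb\<close>, with \<open>j\<^sup>2 = 1\<close>, is the vector with components \<open>a\<close>, \<open>b\<close>.\<close>

definition pc_mult :: "real^2 \<Rightarrow> real^2 \<Rightarrow> real^2" where
  "pc_mult z w = vector [z $ 1 * w $ 1 + z $ 2 * w $ 2, z $ 1 * w $ 2 + z $ 2 * w $ 1]"

definition paraholomorphic_on :: "(real^2) set \<Rightarrow> (real^2 \<Rightarrow> real^2) \<Rightarrow> bool" where
  "paraholomorphic_on D f \<longleftrightarrow> smooth_on D f \<and>
     (\<forall>p\<in>D. \<exists>c. (f has_derivative pc_mult c) (at p))"

type_synonym 'm chart = "'m set \<times> ('m \<Rightarrow> real^2)"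

definition chart_dom :: "'m chart \<Rightarrow> 'm set" where
  "chart_dom c = fst c"

definition chart_img :: "'m chart \<Rightarrow> (real^2) set" where
  "chart_img c = snd c ` fst c"

definition chart_inv :: "'m chart \<Rightarrow> real^2 \<Rightarrow> 'm" where
  "chart_inv c = inv_into (fst c) (snd c)"

definition is_chart :: "'m topology \<Rightarrow> 'm chart \<Rightarrow> bool" where
  "is_chart M c \<longleftrightarrow> openin M (chart_dom c) \<and> open (chart_img c) \<and>
     homeomorphic_map (subtopology M (chart_dom c)) (top_of_set (chart_img c)) (snd c)"

definition compatible :: "'m chart \<Rightarrow> 'm chart \<Rightarrow> bool" where
  "compatible c d \<longleftrightarrow>
     paraholomorphic_on (snd c ` (chart_dom c \<inter> chart_dom d)) (snd d \<circ> chart_inv c)"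

text \<open>The atlas is not required to be maximal. This matters for \<open>conformal_timelike\<close> below:
  multiplying a coordinate by \<open>j\<close> is a paraholomorphic change of coordinates that turns
  \<open>du\<^sup>2 - dv\<^sup>2\<close> into its negative, so no metric has the required form in all coordinates of a
  maximal paraholomorphic atlas.\<close>

definition lorentz_surface :: "'m topology \<Rightarrow> 'm chart set \<Rightarrow> bool" where
  "lorentz_surface M A \<longleftrightarrow> Hausdorff_space M \<and> second_countable M \<and>
     (\<forall>c\<in>A. is_chart M c) \<and> (\<Union>c\<in>A. chart_dom c) = topspace M \<and>
     (\<forall>c\<in>A. \<forall>d\<in>A. compatible c d)"

section \<open>Neutral space forms\<close>

text \<open>\<open>real^'n\<close> with the form \<open>pinner S\<close> is the pseudo-Euclidean space of dimension \<open>CARD('n)\<close>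
  and index \<open>card S\<close>, the set \<open>S\<close> listing the coordinates with a minus sign.\<close>

definition pinner :: "'n::finite set \<Rightarrow> real^'n \<Rightarrow> real^'n \<Rightarrow> real" where
  "pinner S x y = (\<Sum>i\<in>UNIV. (if i \<in> S then -1 else 1) * x $ i * y $ i)"

definition neutral_ambient :: "'n::finite set \<Rightarrow> real \<Rightarrow> bool" where
  "neutral_ambient S L0 \<longleftrightarrow>
     (L0 = 0 \<and> CARD('n) = 4 \<and> card S = 2) \<or>
     (L0 > 0 \<and> CARD('n) = 5 \<and> card S = 2) \<or>
     (L0 < 0 \<and> CARD('n) = 5 \<and> card S = 3)"

definition space_form :: "'n::finite set \<Rightarrow> real \<Rightarrow> (real^'n) set" where
  "space_form S L0 = (if L0 = 0 then UNIV else {x. pinner S x x = 1 / L0})"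

definition tangent_space :: "'n::finite set \<Rightarrow> real \<Rightarrow> real^'n \<Rightarrow> (real^'n) set" where
  "tangent_space S L0 x = (if L0 = 0 then UNIV else {y. pinner S x y = 0})"

text \<open>Orthogonal projection to a subspace \<open>W\<close>, meaningful when \<open>pinner S\<close> is nondegenerate
  on \<open>W\<close>.\<close>

definition pproj :: "'n::finite set \<Rightarrow> (real^'n) set \<Rightarrow> real^'n \<Rightarrow> real^'n" where
  "pproj S W x = (THE y. y \<in> W \<and> (\<forall>z\<in>W. pinner S (x - y) z = 0))"

section \<open>Geometry of a map from a coordinate domain to a space form\<close>

definition induced_metric :: "'n::finite set \<Rightarrow> (real^2 \<Rightarrow> real^'n) \<Rightarrow> real^2 \<Rightarrow> real^2^2" where
  "induced_metric S f p = (\<chi> i j. pinner S (pd i f p) (pd j f p))"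

text \<open>\<open>cov_deriv S L0 f i \<xi> p\<close> is the derivative along \<open>pd i f\<close>, for the Levi-Civita connection
  of the space form, of a vector field \<open>\<xi>\<close> along \<open>f\<close> tangent to the space form.\<close>

definition cov_deriv ::
  "'n::finite set \<Rightarrow> real \<Rightarrow> (real^2 \<Rightarrow> real^'n) \<Rightarrow> 2 \<Rightarrow> (real^2 \<Rightarrow> real^'n) \<Rightarrow> real^2 \<Rightarrow> real^'n" where
  "cov_deriv S L0 f i \<xi> p = pproj S (tangent_space S L0 (f p)) (pd i \<xi> p)"

definition normal_space ::
  "'n::finite set \<Rightarrow> real \<Rightarrow> (real^2 \<Rightarrow> real^'n) \<Rightarrow> real^2 \<Rightarrow> (real^'n) set" where
  "normal_space S L0 f p =
     {\<xi> \<in> tangent_space S L0 (f p). \<forall>i. pinner S \<xi> (pd i f p) = 0}"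

definition normal_part ::
  "'n::finite set \<Rightarrow> real \<Rightarrow> (real^2 \<Rightarrow> real^'n) \<Rightarrow> real^2 \<Rightarrow> real^'n \<Rightarrow> real^'n" where
  "normal_part S L0 f p = pproj S (normal_space S L0 f p)"

definition normal_conn ::
  "'n::finite set \<Rightarrow> real \<Rightarrow> (real^2 \<Rightarrow> real^'n) \<Rightarrow> 2 \<Rightarrow> (real^2 \<Rightarrow> real^'n) \<Rightarrow> real^2 \<Rightarrow> real^'n" where
  "normal_conn S L0 f i \<xi> p = normal_part S L0 f p (cov_deriv S L0 f i \<xi> p)"

definition second_ff ::
  "'n::finite set \<Rightarrow> real \<Rightarrow> (real^2 \<Rightarrow> real^'n) \<Rightarrow> 2 \<Rightarrow> 2 \<Rightarrow> real^2 \<Rightarrow> real^'n" where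
  "second_ff S L0 f i j p = normal_part S L0 f p (cov_deriv S L0 f i (pd j f) p)"

definition mean_curvature_vector ::
  "'n::finite set \<Rightarrow> real \<Rightarrow> (real^2 \<Rightarrow> real^'n) \<Rightarrow> real^2 \<Rightarrow> real^'n" where
  "mean_curvature_vector S L0 f p =
     (1/2) *\<^sub>R (\<Sum>i\<in>UNIV. \<Sum>j\<in>UNIV.
        matrix_inv (induced_metric S f p) $ i $ j *\<^sub>R second_ff S L0 f i j p)"

section \<open>Curvature of a metric on a coordinate domain\<close>

text \<open>\<open>christoffel g k i j\<close> is the coefficient of the \<open>k\<close>-th coordinate field in the Levi-Civita
  derivative of the \<open>j\<close>-th coordinate field along the \<open>i\<close>-th one.\<close>

definition christoffel :: "(real^2 \<Rightarrow> real^2^2) \<Rightarrow> 2 \<Rightarrow> 2 \<Rightarrow> 2 \<Rightarrow> real^2 \<Rightarrow> real" where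
  "christoffel g k i j p = (1/2) * (\<Sum>l\<in>UNIV. matrix_inv (g p) $ k $ l *
     (pd i (\<lambda>q. g q $ j $ l) p + pd j (\<lambda>q. g q $ i $ l) p - pd l (\<lambda>q. g q $ i $ j) p))"

text \<open>\<open>riemann g l k i j\<close> is the \<open>l\<close>-th component of \<open>R(\<partial>\<^sub>i, \<partial>\<^sub>j) \<partial>\<^sub>k\<close>, where
  \<open>R(X, Y) = [\<nabla>\<^sub>X, \<nabla>\<^sub>Y] - \<nabla>\<^bsub>[X, Y]\<^esub>\<close>.\<close>

definition riemann :: "(real^2 \<Rightarrow> real^2^2) \<Rightarrow> 2 \<Rightarrow> 2 \<Rightarrow> 2 \<Rightarrow> 2 \<Rightarrow> real^2 \<Rightarrow> real" where
  "riemann g l k i j p =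
     pd i (christoffel g l j k) p - pd j (christoffel g l i k) p
     + (\<Sum>m\<in>UNIV. christoffel g l i m p * christoffel g m j k p
                  - christoffel g l j m p * christoffel g m i k p)"

text \<open>\<open>g(R(\<partial>\<^sub>1, \<partial>\<^sub>2) \<partial>\<^sub>2, \<partial>\<^sub>1) / (g\<^sub>1\<^sub>1 g\<^sub>2\<^sub>2 - g\<^sub>1\<^sub>2\<^sup>2)\<close>\<close>

definition gauss_curvature :: "(real^2 \<Rightarrow> real^2^2) \<Rightarrow> real^2 \<Rightarrow> real" where
  "gauss_curvature g p = (\<Sum>l\<in>UNIV. g p $ l $ 1 * riemann g l 2 1 2 p) / det (g p)"

section \<open>Immersions of Lorentz surfaces\<close>

definition in_chart :: "('m \<Rightarrow> real^'n) \<Rightarrow> 'm chart \<Rightarrow> real^2 \<Rightarrow> real^'n" where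
  "in_chart F c = F \<circ> chart_inv c"

definition immersion_into ::
  "'m topology \<Rightarrow> 'm chart set \<Rightarrow> (real^'n) set \<Rightarrow> ('m \<Rightarrow> real^'n::finite) \<Rightarrow> bool" where
  "immersion_into M A N F \<longleftrightarrow> F ` topspace M \<subseteq> N \<and>
     (\<forall>c\<in>A. smooth_on (chart_img c) (in_chart F c) \<and>
        (\<forall>p\<in>chart_img c. inj (frechet_derivative (in_chart F c) (at p))))"

text \<open>\<open>g = e\<^bsup>2\<lambda>\<^esup> (du\<^sup>2 - dv\<^sup>2)\<close> on \<open>D\<close>.\<close>

definition conformal_exponent ::
  "(real^2) set \<Rightarrow> (real^2 \<Rightarrow> real^2^2) \<Rightarrow> (real^2 \<Rightarrow> real) \<Rightarrow> bool" where
  "conformal_exponent D g lam \<longleftrightarrow> smooth_on D lam \<and>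
     (\<forall>p\<in>D. g p $ 1 $ 1 = exp (2 * lam p) \<and> g p $ 2 $ 2 = - exp (2 * lam p) \<and>
            g p $ 1 $ 2 = 0 \<and> g p $ 2 $ 1 = 0)"

definition conformal_timelike :: "'n::finite set \<Rightarrow> 'm chart set \<Rightarrow> ('m \<Rightarrow> real^'n) \<Rightarrow> bool" where
  "conformal_timelike S A F \<longleftrightarrow>
     (\<forall>c\<in>A. \<exists>lam. conformal_exponent (chart_img c) (induced_metric S (in_chart F c)) lam)"

definition zero_mean_curvature ::
  "'n::finite set \<Rightarrow> real \<Rightarrow> 'm chart set \<Rightarrow> ('m \<Rightarrow> real^'n) \<Rightarrow> bool" where
  "zero_mean_curvature S L0 A F \<longleftrightarrow>
     (\<forall>c\<in>A. \<forall>p\<in>chart_img c. mean_curvature_vector S L0 (in_chart F c) p = 0)"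

definition has_constant_curvature ::
  "'n::finite set \<Rightarrow> 'm chart set \<Rightarrow> ('m \<Rightarrow> real^'n) \<Rightarrow> real \<Rightarrow> bool" where
  "has_constant_curvature S A F k \<longleftrightarrow>
     (\<forall>c\<in>A. \<forall>p\<in>chart_img c. gauss_curvature (induced_metric S (in_chart F c)) p = k)"

definition normal_frame ::
  "'n::finite set \<Rightarrow> real \<Rightarrow> (real^2) set \<Rightarrow> (real^2 \<Rightarrow> real^'n) \<Rightarrow> (real^2 \<Rightarrow> real) \<Rightarrow>
     (real^2 \<Rightarrow> real^'n) \<Rightarrow> (real^2 \<Rightarrow> real^'n) \<Rightarrow> bool" where
  "normal_frame S L0 D f lam N1 N2 \<longleftrightarrow> smooth_on D N1 \<and> smooth_on D N2 \<and>
     (\<forall>p\<in>D. N1 p \<in> normal_space S L0 f p \<and> N2 p \<in> normal_space S L0 f p \<and>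
        pinner S (N1 p) (N1 p) = exp (2 * lam p) \<and>
        pinner S (N2 p) (N2 p) = - exp (2 * lam p) \<and>
        pinner S (N1 p) (N2 p) = 0)"

definition normal_conn_coeffs ::
  "'n::finite set \<Rightarrow> real \<Rightarrow> (real^2) set \<Rightarrow> (real^2 \<Rightarrow> real^'n) \<Rightarrow> (real^2 \<Rightarrow> real) \<Rightarrow>
     (real^2 \<Rightarrow> real^'n) \<Rightarrow> (real^2 \<Rightarrow> real^'n) \<Rightarrow>
     (real^2 \<Rightarrow> real) \<Rightarrow> (real^2 \<Rightarrow> real) \<Rightarrow> bool" where
  "normal_conn_coeffs S L0 D f lam N1 N2 \<mu>1 \<mu>2 \<longleftrightarrow> smooth_on D \<mu>1 \<and> smooth_on D \<mu>2 \<and>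
     (\<forall>p\<in>D.
        normal_conn S L0 f 1 N1 p = pd 1 lam p *\<^sub>R N1 p + \<mu>1 p *\<^sub>R N2 p \<and>
        normal_conn S L0 f 1 N2 p = \<mu>1 p *\<^sub>R N1 p + pd 1 lam p *\<^sub>R N2 p \<and>
        normal_conn S L0 f 2 N1 p = pd 2 lam p *\<^sub>R N1 p + \<mu>2 p *\<^sub>R N2 p \<and>
        normal_conn S L0 f 2 N2 p = \<mu>2 p *\<^sub>R N1 p + pd 2 lam p *\<^sub>R N2 p)"

end

theory Submission
  imports Defs
begin

text \<open>Write \<open>E = e\<^bsup>2\<lambda>\<^esup>\<close>, \<open>a\<^sub>i = \<langle>f\<^sub>u\<^sub>u, N\<^sub>i\<rangle>\<close> and \<open>b\<^sub>i = \<langle>f\<^sub>u\<^sub>v, N\<^sub>i\<rangle>\<close>. Zero mean curvature means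
  \<open>\<langle>f\<^sub>v\<^sub>v, N\<^sub>i\<rangle> = a\<^sub>i\<close>, so that the second fundamental form is determined by its values on the null
  directions \<open>\<partial>\<^sub>u \<plusminus> \<partial>\<^sub>v\<close>. Up to a factor 2 these values are the normal vectors \<open>P\<close> and \<open>Q\<close> with
  \<open>\<langle>P, N\<^sub>i\<rangle> = a\<^sub>i + b\<^sub>i\<close> and \<open>\<langle>Q, N\<^sub>i\<rangle> = a\<^sub>i - b\<^sub>i\<close>. The structure equations then say the following.

  \<^item> Gauss, with \<open>K = L\<^sub>0\<close>: \<open>P\<close> and \<open>Q\<close> are orthogonal.
  \<^item> Ricci: the normal curvature \<open>(\<mu>\<^sub>2)\<^sub>u - (\<mu>\<^sub>1)\<^sub>v\<close> is a nowhere zero multiple of \<open>P \<and> Q\<close>.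
  \<^item> Codazzi: up to conformal rescaling, \<open>P\<close> is parallel along \<open>\<partial>\<^sub>u - \<partial>\<^sub>v\<close> and \<open>Q\<close> is parallel along
    \<open>\<partial>\<^sub>u + \<partial>\<^sub>v\<close>.

  Where \<open>P \<and> Q = 0\<close>, the Ricci equation gives the claim. Gauss alone does not exclude \<open>P \<and> Q \<noteq> 0\<close>,
  since two non-null orthogonal vectors are independent; this is where Codazzi enters. Near a point
  with \<open>P \<and> Q \<noteq> 0\<close> both vectors are non-null, and since they are orthogonal in a Lorentz plane their
  directions are given by one hyperbolic angle \<open>\<theta>\<close>. For a suitable sign of \<open>\<theta>\<close>, parallelism of \<open>P\<close>
  in one null direction and of \<open>Q\<close> in the other gives
  \<open>\<theta>\<^sub>v - \<theta>\<^sub>u = \<mu>\<^sub>2 - \<mu>\<^sub>1\<close> and \<open>\<theta>\<^sub>v + \<theta>\<^sub>u = \<mu>\<^sub>2 + \<mu>\<^sub>1\<close>. Hence \<open>(\<mu>\<^sub>1, \<mu>\<^sub>2)\<close> is the gradient of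
  \<open>\<theta>\<close>, and \<open>(\<mu>\<^sub>1)\<^sub>v = (\<mu>\<^sub>2)\<^sub>u\<close> since mixed partial derivatives commute.

  The case \<open>P \<and> Q \<noteq> 0\<close> is \<open>closed_of_null_sections\<close>, a statement about functions only, which works with
  \<open>\<phi> = e\<^bsup>2\<theta>\<^esup>\<close> up to sign. The structure equations are obtained in the ambient pseudo-Euclidean space by
  differentiating inner products of \<open>f\<^sub>u, f\<^sub>v, N\<^sub>1, N\<^sub>2, f\<close> and expanding the remaining products of
  derivatives in this orthogonal basis (\<open>parseval\<close>).\<close>

section \<open>Partial derivatives and smoothness\<close>

lemma pd_eqI: "(f has_derivative f') (at p) \<Longrightarrow> pd i f p = f' (axis i 1)"
  unfolding pd_def using frechet_derivative_at by metis

text \<open>Where neither function has a derivative, both Frechet derivatives are the same arbitrary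
  choice.\<close>

lemma pd_cong_open:
  assumes "open D" "p \<in> D" "\<And>q. q \<in> D \<Longrightarrow> f q = g q"
  shows "pd i f p = pd i g p"
proof -
  have "(f has_derivative f') (at p) \<longleftrightarrow> (g has_derivative f') (at p)" for f'
    using assms has_derivative_transform_within_open[of _ f' p UNIV D] by metis
  then show ?thesis unfolding pd_def frechet_derivative_def by simp
qed

lemma differentiable_cong_open:
  assumes "open D" "p \<in> D" "\<And>q. q \<in> D \<Longrightarrow> f q = g q" "f differentiable (at p)"
  shows "g differentiable (at p)"
  using assms has_derivative_transform_within_open[of f _ p UNIV D g]
  unfolding differentiable_def by blast

lemma smooth_on_subset:
  assumes "smooth_on D f" "D' \<subseteq> D"
  shows "smooth_on D' f"
proof -
  have "Ck_on k D f \<Longrightarrow> Ck_on k D' f" for k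
  proof (induction k arbitrary: f)
    case 0
    then show ?case using assms(2) continuous_on_subset by auto
  next
    case (Suc k)
    then show ?case using assms(2) by auto
  qed
  then show ?thesis using assms(1) unfolding smooth_on_def by blast
qed

lemma smooth_on_differentiable: "smooth_on D f \<Longrightarrow> p \<in> D \<Longrightarrow> f differentiable (at p)"
  unfolding smooth_on_def by (metis Ck_on.simps(2))

lemma smooth_on_continuous_on: "smooth_on D f \<Longrightarrow> continuous_on D f"
  unfolding smooth_on_def by (metis Ck_on.simps(1))

lemma smooth_on_pd: "smooth_on D f \<Longrightarrow> smooth_on D (pd i f)"
proof -
  assume "smooth_on D f"
  moreover have "pd i f = (\<lambda>p. frechet_derivative f (at p) (axis i 1))"
    by (simp add: pd_def fun_eq_iff)
  ultimately show ?thesis unfolding smooth_on_def by (metis Ck_on.simps(2))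
qed

lemma pd_bounded_bilinear:
  assumes "bounded_bilinear b" "X differentiable (at p)" "Y differentiable (at p)"
  shows "pd i (\<lambda>q. b (X q) (Y q)) p = b (pd i X p) (Y p) + b (X p) (pd i Y p)"
proof -
  have "((\<lambda>q. b (X q) (Y q)) has_derivative
     (\<lambda>h. b (X p) (frechet_derivative Y (at p) h) + b (frechet_derivative X (at p) h) (Y p))) (at p)"
    using assms(2,3)[unfolded frechet_derivative_works] by (rule bounded_bilinear.FDERIV[OF assms(1)])
  from pd_eqI[OF this] show ?thesis by (simp add: pd_def)
qed

lemma pd_mult:
  fixes X Y :: "real^2 \<Rightarrow> real"
  assumes "X differentiable (at p)" "Y differentiable (at p)"
  shows "pd i (\<lambda>q. X q * Y q) p = pd i X p * Y p + X p * pd i Y p"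
  using pd_bounded_bilinear[OF bounded_bilinear_mult assms] .

lemma pd_const [simp]: "pd i (\<lambda>q. c) p = 0"
  by (simp add: pd_def)

lemma pd_cmult:
  fixes X :: "real^2 \<Rightarrow> real"
  assumes "X differentiable (at p)"
  shows "pd i (\<lambda>q. c * X q) p = c * pd i X p"
  using pd_mult[of "\<lambda>_. c" p X i] assms by simp

lemma pd_add:
  assumes "X differentiable (at p)" "Y differentiable (at p)"
  shows "pd i (\<lambda>q. X q + Y q) p = pd i X p + pd i Y p"
  using pd_eqI[OF has_derivative_add[OF assms[unfolded frechet_derivative_works]]]
  by (simp add: pd_def)

lemma pd_diff:
  assumes "X differentiable (at p)" "Y differentiable (at p)"
  shows "pd i (\<lambda>q. X q - Y q) p = pd i X p - pd i Y p"
  using pd_eqI[OF has_derivative_diff[OF assms[unfolded frechet_derivative_works]]]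
  by (simp add: pd_def)

lemma pd_minus:
  assumes "X differentiable (at p)"
  shows "pd i (\<lambda>q. - X q) p = - pd i X p"
  using pd_diff[of "\<lambda>_. 0" p X i] assms by simp

lemma pd_exp:
  fixes X :: "real^2 \<Rightarrow> real"
  assumes "X differentiable (at p)"
  shows "pd i (\<lambda>q. exp (X q)) p = exp (X p) * pd i X p"
proof -
  have "((\<lambda>q. exp (X q)) has_derivative (\<lambda>h. exp (X p) * frechet_derivative X (at p) h)) (at p)"
    using assms frechet_derivative_works by (fastforce intro!: derivative_eq_intros)
  from pd_eqI[OF this] show ?thesis by (simp add: pd_def)
qed

lemma differentiable_exp:
  fixes X :: "real^2 \<Rightarrow> real"
  assumes "X differentiable (at p)"
  shows "(\<lambda>q. exp (X q)) differentiable (at p)"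
  using has_derivative_exp[OF assms[unfolded frechet_derivative_works]] differentiableI by blast

lemma pd_divide:
  fixes X Y :: "real^2 \<Rightarrow> real"
  assumes "X differentiable (at p)" "Y differentiable (at p)" "Y p \<noteq> 0"
  shows "pd i (\<lambda>q. X q / Y q) p = (pd i X p * Y p - X p * pd i Y p) / (Y p * Y p)"
  using pd_eqI[OF has_derivative_divide'[OF assms(1,2)[unfolded frechet_derivative_works] assms(3)]]
  by (simp add: pd_def)

lemma pd_inner:
  assumes "X differentiable (at p)"
  shows "pd i (\<lambda>q. X q \<bullet> c) p = pd i X p \<bullet> c"
  using pd_bounded_bilinear[OF bounded_bilinear_inner assms, of "\<lambda>_. c" i] by simp

lemma pd_line:
  fixes f :: "real^2 \<Rightarrow> real"
  assumes "f differentiable (at (q + t *\<^sub>R axis i 1))"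
  shows "((\<lambda>t. f (q + t *\<^sub>R axis i 1)) has_real_derivative pd i f (q + t *\<^sub>R axis i 1)) (at t)"
proof -
  let ?e = "axis i 1 :: real^2" and ?q = "q + t *\<^sub>R axis i 1"
  have f: "(f has_derivative frechet_derivative f (at ?q)) (at ?q)"
    using assms frechet_derivative_works by blast
  have l: "((\<lambda>t. q + t *\<^sub>R ?e) has_derivative (\<lambda>h. h *\<^sub>R ?e)) (at t)"
    by (auto intro!: derivative_eq_intros)
  have "((\<lambda>t. f (q + t *\<^sub>R ?e)) has_derivative (\<lambda>h. frechet_derivative f (at ?q) (h *\<^sub>R ?e))) (at t)"
    using has_derivative_compose[OF l f] .
  moreover have "frechet_derivative f (at ?q) (h *\<^sub>R ?e) = pd i f ?q * h" for h
    using linear_frechet_derivative[OF assms] by (simp add: pd_def linear_cmul)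
  ultimately show ?thesis unfolding has_field_derivative_def by simp
qed

text \<open>The second difference over a small square is symmetric in \<open>i\<close> and \<open>j\<close>. This formula for it, with
  \<open>i\<close> and \<open>j\<close> in either order, therefore compares the two mixed partial derivatives.\<close>

lemma second_difference_mvt:
  fixes f :: "real^2 \<Rightarrow> real"
  assumes ball: "ball p r \<subseteq> D" and h: "0 < h" "2 * h < r"
    and f: "\<And>q. q \<in> D \<Longrightarrow> f differentiable (at q)"
    and fi: "\<And>q. q \<in> D \<Longrightarrow> pd i f differentiable (at q)"
  shows "\<exists>q. dist p q < 2 * h \<and>
    f (p + h *\<^sub>R axis i 1 + h *\<^sub>R axis j 1) - f (p + h *\<^sub>R axis i 1)
      - f (p + h *\<^sub>R axis j 1) + f p = h * h * pd j (pd i f) q"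
proof -
  let ?i = "axis i 1 :: real^2" and ?j = "axis j 1 :: real^2"
  have near: "dist p (p + a *\<^sub>R ?i + b *\<^sub>R ?j) \<le> a + b" if "0 \<le> a" "0 \<le> b" for a b
  proof -
    have "dist p (p + a *\<^sub>R ?i + b *\<^sub>R ?j) = norm (a *\<^sub>R ?i + b *\<^sub>R ?j)"
      by (metis add.assoc add_diff_cancel_left' dist_commute dist_norm)
    also have "\<dots> \<le> a + b"
      using norm_triangle_ineq[of "a *\<^sub>R ?i" "b *\<^sub>R ?j"] that by simp
    finally show ?thesis .
  qed
  have inD: "p + a *\<^sub>R ?i + b *\<^sub>R ?j \<in> D" if "0 \<le> a" "0 \<le> b" "a \<le> h" "b \<le> h" for a b
    using near[OF that(1,2)] that h ball by (simp add: subset_iff)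
  \<comment> \<open>The mean value theorem in direction \<open>i\<close> for the difference in direction \<open>j\<close>, and then in
    direction \<open>j\<close> for the resulting derivative.\<close>
  let ?g = "\<lambda>t. f (p + h *\<^sub>R ?j + t *\<^sub>R ?i) - f (p + t *\<^sub>R ?i)"
  have "\<exists>a>0. a < h \<and> ?g h - ?g 0 = (h - 0) *
      (pd i f (p + h *\<^sub>R ?j + a *\<^sub>R ?i) - pd i f (p + a *\<^sub>R ?i))"
  proof (rule MVT2[OF h(1)])
    fix t assume t: "0 \<le> t" "t \<le> h"
    have "p + h *\<^sub>R ?j + t *\<^sub>R ?i \<in> D" "p + t *\<^sub>R ?i \<in> D"
      using inD[of t h] inD[of t 0] t h by (simp_all add: algebra_simps)
    then show "(?g has_real_derivative
        pd i f (p + h *\<^sub>R ?j + t *\<^sub>R ?i) - pd i f (p + t *\<^sub>R ?i)) (at t)"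
      by (intro DERIV_diff pd_line f)
  qed
  then obtain a where a: "0 < a" "a < h"
    and ga: "?g h - ?g 0 = h * (pd i f (p + a *\<^sub>R ?i + h *\<^sub>R ?j) - pd i f (p + a *\<^sub>R ?i))"
    by (auto simp: algebra_simps)
  have "\<exists>b>0. b < h \<and> pd i f (p + a *\<^sub>R ?i + h *\<^sub>R ?j) - pd i f (p + a *\<^sub>R ?i + 0 *\<^sub>R ?j)
      = (h - 0) * pd j (pd i f) (p + a *\<^sub>R ?i + b *\<^sub>R ?j)"
    using inD a h by (intro MVT2 pd_line fi) auto
  then obtain b where b: "0 < b" "b < h"
    and gb: "pd i f (p + a *\<^sub>R ?i + h *\<^sub>R ?j) - pd i f (p + a *\<^sub>R ?i)
      = h * pd j (pd i f) (p + a *\<^sub>R ?i + b *\<^sub>R ?j)"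
    by auto
  show ?thesis
    using near[of a b] a b ga gb
    by (intro exI[of _ "p + a *\<^sub>R ?i + b *\<^sub>R ?j"]) (auto simp: algebra_simps)
qed

text \<open>The hypotheses suit functions known only through their gradient, for which smoothness is not at
  hand.\<close>

lemma mixed_partials_commute_real:
  fixes f :: "real^2 \<Rightarrow> real"
  assumes D: "open D" "p \<in> D"
    and f: "\<And>q. q \<in> D \<Longrightarrow> f differentiable (at q)"
    and fi: "\<And>i q. q \<in> D \<Longrightarrow> pd i f differentiable (at q)"
    and cont: "\<And>i j. continuous (at p) (pd i (pd j f))"
  shows "pd i (pd j f) p = pd j (pd i f) p"
proof (rule ccontr)
  let ?X = "pd j (pd i f)" and ?Y = "pd i (pd j f)"
  assume ne: "?Y p \<noteq> ?X p"
  define e where "e = dist (?Y p) (?X p) / 2"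
  have e: "e > 0" using ne by (simp add: e_def)
  obtain r where r: "r > 0" "ball p r \<subseteq> D" using D open_contains_ball by blast
  obtain d1 where d1: "d1 > 0" "\<And>q. dist q p < d1 \<Longrightarrow> dist (?X q) (?X p) < e"
    using cont e unfolding continuous_at_eps_delta by blast
  obtain d2 where d2: "d2 > 0" "\<And>q. dist q p < d2 \<Longrightarrow> dist (?Y q) (?Y p) < e"
    using cont e unfolding continuous_at_eps_delta by blast
  define h where "h = Min {r, d1, d2} / 3"
  have h: "0 < h" "2 * h < r" "2 * h < d1" "2 * h < d2"
    using r(1) d1(1) d2(1) by (auto simp: h_def)
  obtain x where x: "dist p x < 2 * h" and
    X: "f (p + h *\<^sub>R axis i 1 + h *\<^sub>R axis j 1) - f (p + h *\<^sub>R axis i 1)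
      - f (p + h *\<^sub>R axis j 1) + f p = h * h * ?X x"
    using second_difference_mvt[OF r(2) h(1,2) f fi, of i j] by blast
  obtain y where y: "dist p y < 2 * h" and
    Y: "f (p + h *\<^sub>R axis j 1 + h *\<^sub>R axis i 1) - f (p + h *\<^sub>R axis j 1)
      - f (p + h *\<^sub>R axis i 1) + f p = h * h * ?Y y"
    using second_difference_mvt[OF r(2) h(1,2) f fi, of j i] by blast
  have "h * h * ?X x = h * h * ?Y y"
    using X Y by (simp add: algebra_simps)
  then have "?X x = ?Y y" using h(1) by simp
  moreover have "dist (?X x) (?X p) < e" "dist (?Y y) (?Y p) < e"
    using d1(2)[of x] d2(2)[of y] x y h by (simp_all add: dist_commute)
  ultimately have "dist (?Y p) (?X p) < dist (?Y p) (?X p)"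
    unfolding e_def by (metis dist_commute dist_triangle_half_l)
  then show False by simp
qed

lemma pd_pd_commute:
  fixes f :: "real^2 \<Rightarrow> 'b::real_inner"
  assumes D: "open D" "p \<in> D" and f: "smooth_on D f"
  shows "pd i (pd j f) p = pd j (pd i f) p"
proof -
  have diff: "f differentiable (at q)" "pd i f differentiable (at q)" if "q \<in> D" for i q
    using smooth_on_differentiable smooth_on_pd f that by blast+
  have "pd i (pd j f) p \<bullet> c = pd j (pd i f) p \<bullet> c" for c
  proof -
    let ?f = "\<lambda>q. f q \<bullet> c"
    have d1: "pd i ?f q = pd i f q \<bullet> c" if "q \<in> D" for i q
      using pd_inner diff that by blast
    have d2: "pd i (pd j ?f) q = pd i (pd j f) q \<bullet> c" if "q \<in> D" for i j q
      using pd_cong_open[OF D(1) that d1] pd_inner[OF diff(2)[OF that]] by simp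
    have "pd i (pd j ?f) p = pd j (pd i ?f) p"
    proof (rule mixed_partials_commute_real[OF D])
      show "?f differentiable (at q)" if "q \<in> D" for q
        using diff(1)[OF that] by simp
      show "pd i ?f differentiable (at q)" if "q \<in> D" for i q
      proof (rule differentiable_cong_open[OF D(1) that])
        show "(\<lambda>q. pd i f q \<bullet> c) differentiable (at q)"
          using diff(2)[OF that] by simp
      qed (simp add: d1)
      show "continuous (at p) (pd i (pd j ?f))" for i j
      proof -
        have "continuous_on D (\<lambda>q. pd i (pd j f) q \<bullet> c)"
          by (intro continuous_intros smooth_on_continuous_on smooth_on_pd f)
        then have "continuous_on D (pd i (pd j ?f))"
          using d2 by (simp cong: continuous_on_cong)
        then show ?thesis using D continuous_on_eq_continuous_at by blast
      qed
    qed
    then show ?thesis using d2 D(2) by simp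
  qed
  then show ?thesis by (metis vector_eq_rdot)
qed

section \<open>Null sections and closed connection forms\<close>

text \<open>The hypotheses say that \<open>(\<mu>\<^sub>1, \<mu>\<^sub>2)\<close> is the gradient of \<open>\<theta> = ln \<bar>\<phi>\<bar> / 2\<close>. Working with \<open>\<phi>\<close> avoids
  the logarithm: in both mixed derivatives of \<open>\<phi>\<close> the terms without derivatives of \<open>\<mu>\<^sub>i\<close> are
  \<open>4 \<mu>\<^sub>1 \<mu>\<^sub>2 \<phi>\<close>.\<close>

lemma pd_eq_of_log_derivative:
  fixes \<phi> \<mu>1 \<mu>2 :: "real^2 \<Rightarrow> real"
  assumes D: "open D" "p \<in> D" and mu: "smooth_on D \<mu>1" "smooth_on D \<mu>2"
    and diff: "\<And>q. q \<in> D \<Longrightarrow> \<phi> differentiable (at q)" and nz: "\<phi> p \<noteq> 0"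
    and d1: "\<And>q. q \<in> D \<Longrightarrow> pd 1 \<phi> q = 2 * \<mu>1 q * \<phi> q"
    and d2: "\<And>q. q \<in> D \<Longrightarrow> pd 2 \<phi> q = 2 * \<mu>2 q * \<phi> q"
  shows "pd 2 \<mu>1 p = pd 1 \<mu>2 p"
proof -
  define m where "m i = (if i = 1 then \<mu>1 else \<mu>2)" for i :: 2
  have m: "smooth_on D (m i)" for i using mu by (simp add: m_def)
  have d: "pd i \<phi> q = 2 * (m i q * \<phi> q)" if "q \<in> D" for i q
    using d1[OF that] d2[OF that] exhaust_2[of i] by (auto simp: m_def)
  have mdiff: "m i differentiable (at q)" if "q \<in> D" for i q
    using m smooth_on_differentiable that by blast
  have rdiff: "(\<lambda>q. m i q * \<phi> q) differentiable (at q)" if "q \<in> D" for i q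
    using mdiff[OF that] diff[OF that] by simp
  have dd: "pd j (pd i \<phi>) q = 2 * (pd j (m i) q * \<phi> q + m i q * (2 * (m j q * \<phi> q)))"
    if "q \<in> D" for i j q
  proof -
    have "pd j (pd i \<phi>) q = pd j (\<lambda>q. 2 * (m i q * \<phi> q)) q"
      by (rule pd_cong_open[OF D(1) that d])
    also have "\<dots> = 2 * pd j (\<lambda>q. m i q * \<phi> q) q"
      by (rule pd_cmult[OF rdiff[OF that]])
    also have "pd j (\<lambda>q. m i q * \<phi> q) q = pd j (m i) q * \<phi> q + m i q * pd j \<phi> q"
      by (rule pd_mult[OF mdiff[OF that] diff[OF that]])
    finally show ?thesis using d[OF that] by simp
  qed
  have cont: "continuous_on D \<phi>"
    using diff by (simp add: continuous_at_imp_continuous_on differentiable_imp_continuous_within)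
  have "pd 1 (pd 2 \<phi>) p = pd 2 (pd 1 \<phi>) p"
  proof (rule mixed_partials_commute_real[OF D diff])
    show "pd i \<phi> differentiable (at q)" if "q \<in> D" for i q
    proof (rule differentiable_cong_open[OF D(1) that])
      show "(\<lambda>q. 2 * (m i q * \<phi> q)) differentiable (at q)" using rdiff[OF that] by simp
    qed (simp add: d)
    show "continuous (at p) (pd i (pd j \<phi>))" for i j
    proof -
      have "continuous_on D (\<lambda>q. 2 * (pd i (m j) q * \<phi> q + m j q * (2 * (m i q * \<phi> q))))"
        by (intro continuous_intros smooth_on_continuous_on smooth_on_pd m cont)
      then have "continuous_on D (pd i (pd j \<phi>))"
        using dd by (simp cong: continuous_on_cong)
      then show ?thesis using D continuous_on_eq_continuous_at by blast
    qed
  qed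
  then have "pd 1 (m 2) p * \<phi> p = pd 2 (m 1) p * \<phi> p"
    using dd[OF D(2)] by (simp add: algebra_simps)
  then show ?thesis using nz by (simp add: m_def)
qed

text \<open>Let \<open>P\<close> and \<open>Q\<close> be sections of a Lorentz plane bundle with connection form \<open>(\<mu>\<^sub>1, \<mu>\<^sub>2)\<close>, and let
  \<open>s, t\<close> and \<open>s', t'\<close> be their null components, that is the sum and the difference of their inner products
  with the two vectors of an orthonormal frame. The differential equations say that \<open>P\<close>
  and \<open>Q\<close> are parallel, up to scaling, in directions \<open>\<partial>\<^sub>v - \<partial>\<^sub>u\<close> and \<open>\<partial>\<^sub>v + \<partial>\<^sub>u\<close>, and the
  equation \<open>s t' + t s' = 0\<close> says that they are orthogonal. The scaling factors \<open>\<nu>\<^sub>1, \<nu>\<^sub>2\<close> disappear in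
  the quotients \<open>s / t\<close> and \<open>s' / t'\<close>, orthogonality makes these quotients equal up to sign, and so
  one function has a known logarithmic derivative in both null directions.\<close>

lemma closed_of_null_sections:
  fixes s t s' t' \<nu>1 \<nu>2 \<mu>1 \<mu>2 :: "real^2 \<Rightarrow> real"
  assumes D: "open D" "p \<in> D" and mu: "smooth_on D \<mu>1" "smooth_on D \<mu>2"
    and diff: "\<And>q. q \<in> D \<Longrightarrow> s differentiable (at q)" "\<And>q. q \<in> D \<Longrightarrow> t differentiable (at q)"
      "\<And>q. q \<in> D \<Longrightarrow> s' differentiable (at q)" "\<And>q. q \<in> D \<Longrightarrow> t' differentiable (at q)"
    and s: "\<And>q. q \<in> D \<Longrightarrow> pd 2 s q - pd 1 s q = (\<nu>1 q + (\<mu>2 q - \<mu>1 q)) * s q"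
    and t: "\<And>q. q \<in> D \<Longrightarrow> pd 2 t q - pd 1 t q = (\<nu>1 q - (\<mu>2 q - \<mu>1 q)) * t q"
    and s': "\<And>q. q \<in> D \<Longrightarrow> pd 2 s' q + pd 1 s' q = (\<nu>2 q + (\<mu>2 q + \<mu>1 q)) * s' q"
    and t': "\<And>q. q \<in> D \<Longrightarrow> pd 2 t' q + pd 1 t' q = (\<nu>2 q - (\<mu>2 q + \<mu>1 q)) * t' q"
    and orth: "\<And>q. q \<in> D \<Longrightarrow> s q * t' q + t q * s' q = 0"
    and nz: "s p * t' p \<noteq> 0"
  shows "pd 2 \<mu>1 p = pd 1 \<mu>2 p"
proof -
  \<comment> \<open>By orthogonality \<open>s t' \<noteq> 0\<close> gives \<open>t s' \<noteq> 0\<close>, so that \<open>p\<close> lies in this open set.\<close>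
  define D' where "D' = {q \<in> D. t q * t' q \<noteq> 0}"
  have "continuous_on D (\<lambda>q. t q * t' q)"
    using diff by (intro continuous_intros)
      (simp_all add: continuous_at_imp_continuous_on differentiable_imp_continuous_within)
  then have "open D'"
    using continuous_open_preimage[OF _ D(1), of "\<lambda>q. t q * t' q" "- {0}"]
      open_Compl[OF closed_singleton[of 0]]
    by (simp add: D'_def vimage_def Int_def)
  moreover have "p \<in> D'"
    using nz orth[OF D(2)] D(2) by (auto simp: D'_def)
  ultimately have D': "open D'" "p \<in> D'" by auto
  have sub: "D' \<subseteq> D" by (auto simp: D'_def)
  define \<phi> where "\<phi> q = s q / t q" for q
  have phi': "\<phi> q = - (s' q / t' q)" if "q \<in> D'" for q
    using orth[of q] that by (simp add: \<phi>_def D'_def field_simps eq_neg_iff_add_eq_0)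
  have pd_phi: "pd i \<phi> q = (pd i s q * t q - s q * pd i t q) / (t q * t q)" if "q \<in> D'" for i q
    using pd_divide[of s q t i] diff that unfolding \<phi>_def by (simp add: D'_def)
  have pd_phi': "pd i \<phi> q = - ((pd i s' q * t' q - s' q * pd i t' q) / (t' q * t' q))"
    if "q \<in> D'" for i q
  proof -
    have nz': "q \<in> D" "t' q \<noteq> 0" using that by (auto simp: D'_def)
    have "pd i \<phi> q = pd i (\<lambda>q. - (s' q / t' q)) q"
      by (rule pd_cong_open[OF D'(1) that phi'])
    also have "\<dots> = - pd i (\<lambda>q. s' q / t' q) q"
      using diff nz' by (intro pd_minus) simp
    finally show ?thesis using pd_divide[of s' q t' i] diff nz' by simp
  qed
  have y: "pd 2 \<phi> q - pd 1 \<phi> q = 2 * (\<mu>2 q - \<mu>1 q) * \<phi> q" if "q \<in> D'" for q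
  proof -
    have "q \<in> D" "t q \<noteq> 0" using that by (auto simp: D'_def)
    have "pd 2 \<phi> q - pd 1 \<phi> q
      = ((pd 2 s q - pd 1 s q) * t q - s q * (pd 2 t q - pd 1 t q)) / (t q * t q)"
      unfolding pd_phi[OF that] diff_divide_distrib[symmetric] by (simp add: algebra_simps)
    also have "\<dots> = 2 * (\<mu>2 q - \<mu>1 q) * s q * t q / (t q * t q)"
      unfolding s[OF \<open>q \<in> D\<close>] t[OF \<open>q \<in> D\<close>] by (simp add: algebra_simps)
    finally show ?thesis using \<open>t q \<noteq> 0\<close> by (simp add: \<phi>_def)
  qed
  have x: "pd 2 \<phi> q + pd 1 \<phi> q = 2 * (\<mu>2 q + \<mu>1 q) * \<phi> q" if "q \<in> D'" for q
  proof -
    have "q \<in> D" "t' q \<noteq> 0" using that by (auto simp: D'_def)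
    have "pd 2 \<phi> q + pd 1 \<phi> q
      = - (((pd 2 s' q + pd 1 s' q) * t' q - s' q * (pd 2 t' q + pd 1 t' q)) / (t' q * t' q))"
      using that by (simp add: pd_phi' diff_divide_distrib add_divide_distrib algebra_simps)
    also have "\<dots> = - (2 * (\<mu>2 q + \<mu>1 q) * s' q * t' q / (t' q * t' q))"
      unfolding s'[OF \<open>q \<in> D\<close>] t'[OF \<open>q \<in> D\<close>] by (simp add: algebra_simps)
    finally show ?thesis using \<open>t' q \<noteq> 0\<close> phi'[OF that] by simp
  qed
  show ?thesis
  proof (rule pd_eq_of_log_derivative[OF D'])
    show "smooth_on D' \<mu>1" "smooth_on D' \<mu>2" using mu sub smooth_on_subset by blast+
    show "\<phi> differentiable (at q)" if "q \<in> D'" for q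
      using diff that unfolding \<phi>_def by (simp add: D'_def)
    show "\<phi> p \<noteq> 0" using nz D'(2) by (auto simp: \<phi>_def D'_def)
    show "pd 1 \<phi> q = 2 * \<mu>1 q * \<phi> q" "pd 2 \<phi> q = 2 * \<mu>2 q * \<phi> q" if "q \<in> D'" for q
      using x[OF that] y[OF that] by (simp_all add: algebra_simps)
  qed
qed

section \<open>Linear algebra of the pseudo-Euclidean form\<close>

lemma bounded_bilinear_pinner: "bounded_bilinear (pinner S :: real^'n::finite \<Rightarrow> real^'n \<Rightarrow> real)"
  unfolding bilinear_conv_bounded_bilinear[symmetric] bilinear_def
  by (auto intro!: linearI simp: pinner_def sum.distrib sum_distrib_left algebra_simps)

interpretation pinner: bounded_bilinear "pinner S :: real^'n::finite \<Rightarrow> real^'n \<Rightarrow> real"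
  for S :: "'n::finite set"
  by (rule bounded_bilinear_pinner)

lemma pinner_commute: "pinner S x y = pinner S y x"
  by (simp add: pinner_def mult.assoc mult.left_commute mult.commute)

lemma pinner_nondegenerate:
  assumes "\<And>y. pinner S x y = 0"
  shows "x = 0"
proof -
  have "pinner S x (axis i 1) = (if i \<in> S then -1 else 1) * x $ i" for i
    unfolding pinner_def axis_def by (simp add: if_distrib cong: if_cong)
  then have "x $ i = 0" for i using assms by (metis mult_eq_0_iff neg_equal_0_iff_equal one_neq_zero)
  then show ?thesis by (simp add: vec_eq_iff)
qed

lemma pd_pinner:
  assumes "X differentiable (at p)" "Y differentiable (at p)"
  shows "pd i (\<lambda>q. pinner S (X q) (Y q)) p = pinner S (pd i X p) (Y p) + pinner S (X p) (pd i Y p)"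
  using pd_bounded_bilinear[OF bounded_bilinear_pinner assms] .

lemma differentiable_pinner:
  assumes "X differentiable (at p)" "Y differentiable (at p)"
  shows "(\<lambda>q. pinner S (X q) (Y q)) differentiable (at p)"
  using pinner.FDERIV[OF assms[unfolded frechet_derivative_works]] differentiableI by blast

text \<open>Non-null pairwise orthogonal vectors are independent, so that \<open>CARD('n)\<close> of them span the space;
  a vector orthogonal to all of them then vanishes because the form is nondegenerate.\<close>

lemma orthogonal_basis_expansion:
  fixes S :: "'n::finite set"
  assumes B: "finite B" "card B = CARD('n)"
    and nonnull: "\<And>b. b \<in> B \<Longrightarrow> pinner S b b \<noteq> 0"
    and orth: "\<And>b c. b \<in> B \<Longrightarrow> c \<in> B \<Longrightarrow> b \<noteq> c \<Longrightarrow> pinner S b c = 0"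
  shows "x = (\<Sum>b\<in>B. (pinner S x b / pinner S b b) *\<^sub>R b)"
proof -
  have comp: "pinner S (\<Sum>b\<in>B. u b *\<^sub>R b) c = u c * pinner S c c" if "c \<in> B" for u c
  proof -
    have "pinner S (\<Sum>b\<in>B. u b *\<^sub>R b) c = (\<Sum>b\<in>B. if b = c then u c * pinner S c c else 0)"
      unfolding pinner.sum_left using orth that
      by (intro sum.cong) (auto simp: pinner.scaleR_left)
    then show ?thesis using B(1) that by simp
  qed
  have "independent B"
  proof (rule independent_if_scalars_zero[OF B(1)])
    fix u c assume "(\<Sum>b\<in>B. u b *\<^sub>R b) = 0" "c \<in> B"
    then show "u c = 0" using comp[of c u] nonnull by (simp add: pinner.zero_left)
  qed
  then have span: "span B = UNIV"
    using card_eq_dim[of B UNIV] B by (simp add: top.extremum_unique)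
  let ?d = "x - (\<Sum>b\<in>B. (pinner S x b / pinner S b b) *\<^sub>R b)"
  have "pinner S ?d y = 0" for y
  proof -
    have "y \<in> span B" by (simp add: span)
    then show ?thesis
    proof (induction rule: span_induct_alt)
      case base show ?case by (simp add: pinner.zero_right)
    next
      case (step c b y)
      have "pinner S ?d b = 0"
        using comp[OF step(1)] nonnull[OF step(1)] by (simp add: pinner.diff_left)
      then show ?case using step by (simp add: pinner.add_right pinner.scaleR_right)
    qed
  qed
  then show ?thesis using pinner_nondegenerate eq_iff_diff_eq_0 by blast
qed

text \<open>The nondegeneracy of the form on \<open>W\<close> gives the uniqueness that the definite description in
  \<open>pproj_def\<close> needs.\<close>

lemma pproj_eqI:
  assumes "subspace W" "y \<in> W" "\<And>z. z \<in> W \<Longrightarrow> pinner S (x - y) z = 0"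
    and nondeg: "\<And>d. d \<in> W \<Longrightarrow> (\<And>z. z \<in> W \<Longrightarrow> pinner S d z = 0) \<Longrightarrow> d = 0"
  shows "pproj S W x = y"
  unfolding pproj_def
proof (rule the_equality)
  fix y' assume y': "y' \<in> W \<and> (\<forall>z\<in>W. pinner S (x - y') z = 0)"
  have "y' - y = 0"
  proof (rule nondeg)
    show "y' - y \<in> W" using assms(1,2) y' by (simp add: subspace_diff)
    fix z assume "z \<in> W"
    then have "pinner S (x - y) z - pinner S (x - y') z = 0" using assms(3) y' by simp
    then show "pinner S (y' - y) z = 0" by (simp add: pinner.diff_left)
  qed
  then show "y' = y" by simp
qed (use assms in auto)

lemma subspace_tangent_space: "subspace (tangent_space S L0 x)"
  by (auto simp: subspace_def tangent_space_def pinner.zero_right pinner.add_right pinner.scaleR_right)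

lemma subspace_normal_space: "subspace (normal_space S L0 f p)"
  using subspace_tangent_space[of S L0 "f p"]
  by (auto simp: subspace_def normal_space_def pinner.zero_left pinner.add_left pinner.scaleR_left)

text \<open>In the quadric the projection is \<open>y - L\<^sub>0 \<langle>y, x\<rangle> x\<close>. Only products with tangent vectors are ever
  taken, and these do not see the projection.\<close>

lemma pinner_tangent_projection:
  assumes x: "x \<in> space_form S L0" and z: "z \<in> tangent_space S L0 x"
  shows "pinner S (pproj S (tangent_space S L0 x) y) z = pinner S y z"
proof (cases "L0 = 0")
  case True
  then have "pproj S (tangent_space S L0 x) y = y"
    using pinner_nondegenerate
    by (intro pproj_eqI[OF subspace_tangent_space]) (auto simp: tangent_space_def pinner.zero_left)
  then show ?thesis by simp
next
  case False
  then have xx: "pinner S x x = 1 / L0" and W: "tangent_space S L0 x = {y. pinner S x y = 0}"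
    using x by (simp_all add: space_form_def tangent_space_def)
  have "pproj S (tangent_space S L0 x) y = y - (L0 * pinner S y x) *\<^sub>R x"
  proof (rule pproj_eqI[OF subspace_tangent_space])
    show "y - (L0 * pinner S y x) *\<^sub>R x \<in> tangent_space S L0 x"
      using xx False by (simp add: W pinner.diff_right pinner.scaleR_right pinner_commute[of S x y])
    show "pinner S (y - (y - (L0 * pinner S y x) *\<^sub>R x)) z = 0" if "z \<in> tangent_space S L0 x" for z
      using that by (simp add: W pinner.scaleR_left)
    fix d assume d: "d \<in> tangent_space S L0 x"
      and orth: "\<And>z. z \<in> tangent_space S L0 x \<Longrightarrow> pinner S d z = 0"
    show "d = 0"
    proof (rule pinner_nondegenerate)
      fix y
      have "y - (L0 * pinner S x y) *\<^sub>R x \<in> tangent_space S L0 x"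
        using xx False by (simp add: W pinner.diff_right pinner.scaleR_right)
      from orth[OF this] show "pinner S d y = 0"
        using d by (simp add: W pinner.diff_right pinner.scaleR_right pinner_commute[of S d x])
    qed
  qed
  then show ?thesis using z by (simp add: W pinner.diff_left pinner.scaleR_left)
qed

section \<open>Curvature of a conformally flat Lorentz metric\<close>

lemma matrix_inv_diag:
  fixes A :: "real^2^2"
  assumes "A $ 1 $ 2 = 0" "A $ 2 $ 1 = 0" "A $ 1 $ 1 \<noteq> 0" "A $ 2 $ 2 \<noteq> 0"
  shows "matrix_inv A $ 1 $ 1 = inverse (A $ 1 $ 1)" "matrix_inv A $ 2 $ 2 = inverse (A $ 2 $ 2)"
    "matrix_inv A $ 1 $ 2 = 0" "matrix_inv A $ 2 $ 1 = 0"
proof -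
  let ?B = "\<chi> i j. if i = j then inverse (A $ i $ i) else 0 :: real^2^2"
  have "A ** ?B = mat 1 \<and> ?B ** A = mat 1"
    using assms by (simp add: vec_eq_iff matrix_matrix_mult_def mat_def forall_2 sum_2)
  then have "A ** matrix_inv A = mat 1 \<and> matrix_inv A ** A = mat 1"
    unfolding matrix_inv_def by (rule someI)
  then have "A ** matrix_inv A = mat 1" by blast
  then show "matrix_inv A $ 1 $ 1 = inverse (A $ 1 $ 1)" "matrix_inv A $ 2 $ 2 = inverse (A $ 2 $ 2)"
    "matrix_inv A $ 1 $ 2 = 0" "matrix_inv A $ 2 $ 1 = 0"
    using assms
    by (auto simp: vec_eq_iff matrix_matrix_mult_def mat_def forall_2 sum_2 inverse_eq_divide
        nonzero_eq_divide_eq mult.commute)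
qed

text \<open>For \<open>e\<^bsup>2\<lambda>\<^esup>(du\<^sup>2 - dv\<^sup>2)\<close> each Christoffel symbol is a first derivative of \<open>\<lambda>\<close>, and the quadratic
  terms of the curvature cancel.\<close>

lemma gauss_curvature_conformal:
  assumes D: "open D" "p \<in> D" and conf: "conformal_exponent D g lam"
  shows "gauss_curvature g p = - (pd 1 (pd 1 lam) p - pd 2 (pd 2 lam) p) / exp (2 * lam p)"
proof -
  have g: "g q $ 1 $ 1 = exp (2 * lam q)" "g q $ 2 $ 2 = - exp (2 * lam q)"
    "g q $ 1 $ 2 = 0" "g q $ 2 $ 1 = 0" if "q \<in> D" for q
    using conf that by (auto simp: conformal_exponent_def)
  have diff: "lam differentiable (at q)" if "q \<in> D" for q
    using conf smooth_on_differentiable that unfolding conformal_exponent_def by blast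
  have pe: "pd i (\<lambda>q. exp (2 * lam q)) q = 2 * exp (2 * lam q) * pd i lam q" if "q \<in> D" for i q
    using pd_exp[of "\<lambda>q. 2 * lam q" q i] pd_cmult[of lam q i 2] diff[OF that] by simp
  have dg: "pd i (\<lambda>q. g q $ 1 $ 1) q = 2 * exp (2 * lam q) * pd i lam q"
    "pd i (\<lambda>q. g q $ 2 $ 2) q = - (2 * exp (2 * lam q) * pd i lam q)"
    "pd i (\<lambda>q. g q $ 1 $ 2) q = 0" "pd i (\<lambda>q. g q $ 2 $ 1) q = 0" if "q \<in> D" for i q
  proof -
    show "pd i (\<lambda>q. g q $ 1 $ 1) q = 2 * exp (2 * lam q) * pd i lam q"
      using pd_cong_open[OF D(1) that g(1)] pe[OF that] by simp
    show "pd i (\<lambda>q. g q $ 2 $ 2) q = - (2 * exp (2 * lam q) * pd i lam q)"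
      using pd_cong_open[OF D(1) that g(2)] pe[OF that] diff[OF that]
      by (simp add: pd_minus differentiable_exp)
    show "pd i (\<lambda>q. g q $ 1 $ 2) q = 0" "pd i (\<lambda>q. g q $ 2 $ 1) q = 0"
      using pd_cong_open[OF D(1) that g(3)] pd_cong_open[OF D(1) that g(4)] by simp_all
  qed
  have ch: "christoffel g 1 1 1 q = pd 1 lam q" "christoffel g 1 1 2 q = pd 2 lam q"
    "christoffel g 1 2 1 q = pd 2 lam q" "christoffel g 1 2 2 q = pd 1 lam q"
    "christoffel g 2 1 1 q = pd 2 lam q" "christoffel g 2 1 2 q = pd 1 lam q"
    "christoffel g 2 2 1 q = pd 1 lam q" "christoffel g 2 2 2 q = pd 2 lam q" if "q \<in> D" for q
    unfolding christoffel_def sum_2 dg[OF that]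
    using matrix_inv_diag[of "g q"] g[OF that] by (simp_all add: field_simps)
  have "pd 1 (christoffel g 1 2 2) p = pd 1 (pd 1 lam) p"
    using pd_cong_open[OF D ch(4)] .
  moreover have "pd 2 (christoffel g 1 1 2) p = pd 2 (pd 2 lam) p"
    using pd_cong_open[OF D ch(2)] .
  ultimately show ?thesis
    unfolding gauss_curvature_def riemann_def sum_2 det_2
    using ch[OF D(2)] g[OF D(2)] by (simp add: field_simps)
qed

section \<open>Minimal time-like surfaces with the curvature of the ambient space\<close>

text \<open>The situation on one coordinate domain: the vanishing of the mean curvature and \<open>K = L\<^sub>0\<close> are
  conditions on the immersion near each point.\<close>

locale minimal_surface_frame =
  fixes S :: "'n::finite set" and L0 :: real and D :: "(real^2) set"
    and f N1 N2 :: "real^2 \<Rightarrow> real^'n" and lam \<mu>1 \<mu>2 :: "real^2 \<Rightarrow> real"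
  assumes ambient: "neutral_ambient S L0"
    and D_open: "open D"
    and f_smooth: "smooth_on D f"
    and f_in: "\<And>p. p \<in> D \<Longrightarrow> f p \<in> space_form S L0"
    and conf: "conformal_exponent D (induced_metric S f) lam"
    and frame: "normal_frame S L0 D f lam N1 N2"
    and conn: "normal_conn_coeffs S L0 D f lam N1 N2 \<mu>1 \<mu>2"
    and minimal: "\<And>p. p \<in> D \<Longrightarrow> mean_curvature_vector S L0 f p = 0"
    and curvature: "\<And>p. p \<in> D \<Longrightarrow> gauss_curvature (induced_metric S f) p = L0"
begin

abbreviation ip :: "real^'n \<Rightarrow> real^'n \<Rightarrow> real" where
  "ip \<equiv> pinner S"

abbreviation E :: "real^2 \<Rightarrow> real" where
  "E p \<equiv> exp (2 * lam p)"

lemma smooth: "smooth_on D N1" "smooth_on D N2" "smooth_on D \<mu>1" "smooth_on D \<mu>2" "smooth_on D lam"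
  using frame conn conf
  by (simp_all add: normal_frame_def normal_conn_coeffs_def conformal_exponent_def)

lemma diff_frame:
  assumes "p \<in> D"
  shows "f differentiable (at p)" "pd i f differentiable (at p)" "pd i (pd j f) differentiable (at p)"
    "N1 differentiable (at p)" "N2 differentiable (at p)"
    "pd i N1 differentiable (at p)" "pd i N2 differentiable (at p)"
    "\<mu>1 differentiable (at p)" "\<mu>2 differentiable (at p)"
    "lam differentiable (at p)" "pd i lam differentiable (at p)"
  using assms smooth f_smooth by (blast intro: smooth_on_differentiable smooth_on_pd)+

lemma partials_commute:
  assumes "p \<in> D"
  shows "pd 2 (pd 1 f) p = pd 1 (pd 2 f) p" "pd 2 (pd 1 N1) p = pd 1 (pd 2 N1) p"
    "pd 2 (pd 1 (pd i f)) p = pd 1 (pd 2 (pd i f)) p"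
  using assms smooth f_smooth D_open by (blast intro: pd_pd_commute smooth_on_pd)+

lemma third_partials_commute:
  assumes p: "p \<in> D"
  shows "pd 2 (pd 1 (pd 1 f)) p = pd 1 (pd 1 (pd 2 f)) p"
    "pd 1 (pd 2 (pd 2 f)) p = pd 2 (pd 1 (pd 2 f)) p"
proof -
  have "pd 1 (pd 2 (pd 1 f)) p = pd 1 (pd 1 (pd 2 f)) p"
    by (rule pd_cong_open[OF D_open p]) (rule partials_commute(1))
  then show "pd 2 (pd 1 (pd 1 f)) p = pd 1 (pd 1 (pd 2 f)) p"
    using partials_commute(3)[OF p, of 1] by simp
  show "pd 1 (pd 2 (pd 2 f)) p = pd 2 (pd 1 (pd 2 f)) p"
    using partials_commute(3)[OF p, of 2] by simp
qed

text \<open>The source of all structure equations: a known inner product on \<open>D\<close> is differentiated.\<close>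

lemma pd_ip_of_eq:
  assumes "p \<in> D" and "\<And>q. q \<in> D \<Longrightarrow> X differentiable (at q)" "\<And>q. q \<in> D \<Longrightarrow> Y differentiable (at q)"
    and "\<And>q. q \<in> D \<Longrightarrow> ip (X q) (Y q) = c q"
  shows "ip (pd i X p) (Y p) + ip (X p) (pd i Y p) = pd i c p"
  using pd_cong_open[OF D_open assms(1,4), of "\<lambda>q. q"] pd_pinner[OF assms(2,3)[OF assms(1)]]
  by metis

lemma pd_E:
  assumes "p \<in> D"
  shows "pd i E p = 2 * E p * pd i lam p"
  using pd_exp[of "\<lambda>q. 2 * lam q" p i] pd_cmult[of lam p i 2] diff_frame(10)[OF assms] by simp

lemma pd_minus_E:
  assumes "p \<in> D"
  shows "pd i (\<lambda>q. - E q) p = - (2 * E p * pd i lam p)"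
  using pd_E[OF assms] pd_minus[of E p i] diff_frame(10)[OF assms] by (simp add: differentiable_exp)

lemma frame_products:
  assumes "p \<in> D"
  shows "ip (pd 1 f p) (pd 1 f p) = E p" "ip (pd 2 f p) (pd 2 f p) = - E p"
    "ip (pd 1 f p) (pd 2 f p) = 0" "ip (pd 2 f p) (pd 1 f p) = 0"
    "ip (N1 p) (N1 p) = E p" "ip (N2 p) (N2 p) = - E p"
    "ip (N1 p) (N2 p) = 0" "ip (N2 p) (N1 p) = 0"
    "ip (N1 p) (pd i f p) = 0" "ip (N2 p) (pd i f p) = 0"
    "ip (pd i f p) (N1 p) = 0" "ip (pd i f p) (N2 p) = 0"
  using assms conf frame pinner_commute[of S "pd i f p" "N1 p"] pinner_commute[of S "pd i f p" "N2 p"]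
    pinner_commute[of S "N2 p" "N1 p"]
  by (auto simp: conformal_exponent_def induced_metric_def normal_frame_def normal_space_def)

lemma normal_in:
  assumes "p \<in> D"
  shows "N1 p \<in> normal_space S L0 f p" "N2 p \<in> normal_space S L0 f p"
  using assms frame by (auto simp: normal_frame_def)

lemma position_products:
  assumes "p \<in> D" "L0 \<noteq> 0"
  shows "ip (f p) (f p) = 1 / L0" "ip (f p) (pd i f p) = 0" "ip (pd i f p) (f p) = 0"
    "ip (f p) (N1 p) = 0" "ip (f p) (N2 p) = 0" "ip (N1 p) (f p) = 0" "ip (N2 p) (f p) = 0"
proof -
  have ff: "ip (f q) (f q) = 1 / L0" if "q \<in> D" for q
    using f_in[OF that] assms(2) by (simp add: space_form_def)
  show "ip (f p) (f p) = 1 / L0" using ff assms(1) .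
  show "ip (f p) (pd i f p) = 0" "ip (pd i f p) (f p) = 0"
    using pd_ip_of_eq[OF assms(1) diff_frame(1) diff_frame(1) ff, of i]
    by (simp_all add: pinner_commute[of S "pd i f p"])
  show "ip (f p) (N1 p) = 0" "ip (f p) (N2 p) = 0" "ip (N1 p) (f p) = 0" "ip (N2 p) (f p) = 0"
    using normal_in[OF assms(1)] assms(2) pinner_commute[of S "N1 p" "f p"] pinner_commute[of S "N2 p" "f p"]
    by (simp_all add: normal_space_def tangent_space_def)
qed

text \<open>If \<open>L\<^sub>0 \<noteq> 0\<close>, the position vector, with \<open>\<langle>f, f\<rangle> = 1 / L\<^sub>0\<close>, completes the frame to an orthogonal
  basis. The factor \<open>L\<^sub>0\<close> in the last term makes the formula valid also for \<open>L\<^sub>0 = 0\<close>, where the four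
  frame vectors form a basis.\<close>

lemma expansion:
  assumes p: "p \<in> D"
  shows "E p *\<^sub>R x = ip x (pd 1 f p) *\<^sub>R pd 1 f p - ip x (pd 2 f p) *\<^sub>R pd 2 f p
    + ip x (N1 p) *\<^sub>R N1 p - ip x (N2 p) *\<^sub>R N2 p + (E p * L0 * ip x (f p)) *\<^sub>R f p"
proof -
  note fp = frame_products[OF p]
  let ?B = "{pd 1 f p, pd 2 f p, N1 p, N2 p}"
  have E: "E p \<noteq> 0" by simp
  have dist: "pd 1 f p \<noteq> pd 2 f p" "pd 1 f p \<noteq> N1 p" "pd 1 f p \<noteq> N2 p" "pd 2 f p \<noteq> N1 p"
    "pd 2 f p \<noteq> N2 p" "N1 p \<noteq> N2 p"
    using fp E by (metis neg_equal_0_iff_equal)+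
  show ?thesis
  proof (cases "L0 = 0")
    case True
    have "x = (\<Sum>b\<in>?B. (ip x b / ip b b) *\<^sub>R b)"
      using ambient True dist fp
      by (intro orthogonal_basis_expansion) (auto simp: neutral_ambient_def)
    also have "E p *\<^sub>R \<dots> = ip x (pd 1 f p) *\<^sub>R pd 1 f p - ip x (pd 2 f p) *\<^sub>R pd 2 f p
        + ip x (N1 p) *\<^sub>R N1 p - ip x (N2 p) *\<^sub>R N2 p"
      using dist fp by (simp add: scaleR_right_distrib scaleR_right_diff_distrib)
    finally show ?thesis using True by simp
  next
    case False
    note po = position_products[OF p False]
    have dist': "f p \<noteq> pd 1 f p" "f p \<noteq> pd 2 f p" "f p \<noteq> N1 p" "f p \<noteq> N2 p"
      using po False by (metis divide_eq_0_iff one_neq_zero)+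
    have "x = (\<Sum>b\<in>insert (f p) ?B. (ip x b / ip b b) *\<^sub>R b)"
      using ambient False dist dist' fp po
      by (intro orthogonal_basis_expansion) (auto simp: neutral_ambient_def)
    also have "E p *\<^sub>R \<dots> = ip x (pd 1 f p) *\<^sub>R pd 1 f p - ip x (pd 2 f p) *\<^sub>R pd 2 f p
        + ip x (N1 p) *\<^sub>R N1 p - ip x (N2 p) *\<^sub>R N2 p + (E p * L0 * ip x (f p)) *\<^sub>R f p"
      using dist dist' fp po False by (simp add: scaleR_right_distrib scaleR_right_diff_distrib mult_ac)
    finally show ?thesis .
  qed
qed

lemma parseval:
  assumes "p \<in> D"
  shows "E p * ip x y = ip x (pd 1 f p) * ip y (pd 1 f p) - ip x (pd 2 f p) * ip y (pd 2 f p)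
    + ip x (N1 p) * ip y (N1 p) - ip x (N2 p) * ip y (N2 p) + E p * L0 * ip x (f p) * ip y (f p)"
  using arg_cong[OF expansion[OF assms, of x], of "\<lambda>z. ip z y"]
  by (simp add: pinner.add_left pinner.diff_left pinner.scaleR_left pinner_commute[of S _ y])

text \<open>The normal space is spanned by \<open>N\<^sub>1\<close> and \<open>N\<^sub>2\<close> on account of the dimension (through \<open>parseval\<close>), so
  that the form is nondegenerate on it and the projection exists.\<close>

lemma pinner_normal_part:
  assumes p: "p \<in> D" and z: "z \<in> normal_space S L0 f p"
  shows "ip (normal_part S L0 f p x) z = ip x z"
proof -
  let ?W = "normal_space S L0 f p"
  have W: "ip x' z * E p = ip x' (N1 p) * ip z (N1 p) - ip x' (N2 p) * ip z (N2 p)"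
    if "z \<in> ?W" for x' z
  proof -
    have "ip z (pd i f p) = 0" for i using that by (simp add: normal_space_def)
    moreover have "L0 = 0 \<or> ip z (f p) = 0"
      using that pinner_commute[of S z "f p"]
      by (auto simp: normal_space_def tangent_space_def split: if_splits)
    ultimately show ?thesis
      using parseval[OF p, of x' z] by (auto simp: mult.commute)
  qed
  define y where "y = (ip x (N1 p) / E p) *\<^sub>R N1 p - (ip x (N2 p) / E p) *\<^sub>R N2 p"
  note fp = frame_products[OF p]
  have y1: "ip y (N1 p) = ip x (N1 p)" "ip y (N2 p) = ip x (N2 p)"
    using fp by (simp_all add: y_def pinner.diff_left pinner.scaleR_left)
  have orth: "ip (x - y) z = 0" if "z \<in> ?W" for z
    using W[OF that, of "x - y"] y1 by (simp add: pinner.diff_left)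
  have "normal_part S L0 f p x = y"
    unfolding normal_part_def
  proof (rule pproj_eqI[OF subspace_normal_space _ orth])
    show "y \<in> ?W"
      unfolding y_def using normal_in[OF p]
      by (intro subspace_diff[OF subspace_normal_space] subspace_scale[OF subspace_normal_space])
    fix d assume d: "d \<in> ?W" "\<And>z. z \<in> ?W \<Longrightarrow> ip d z = 0"
    show "d = 0"
    proof (rule pinner_nondegenerate)
      fix v
      have "ip v d * E p = 0"
        using W[OF d(1), of v] d(2)[OF normal_in(1)[OF p]] d(2)[OF normal_in(2)[OF p]] by simp
      then show "ip d v = 0" by (simp add: pinner_commute)
    qed
  qed
  then show ?thesis using orth[OF z] by (simp add: pinner.diff_left)
qed

lemma pinner_normal_part_cov_deriv:
  assumes p: "p \<in> D" and z: "z \<in> normal_space S L0 f p"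
  shows "ip (normal_part S L0 f p (cov_deriv S L0 f i X p)) z = ip (pd i X p) z"
  using pinner_normal_part[OF assms] pinner_tangent_projection[OF f_in[OF p]] z
  by (simp add: cov_deriv_def normal_space_def)

definition a1 where "a1 p = ip (pd 1 (pd 1 f) p) (N1 p)"
definition a2 where "a2 p = ip (pd 1 (pd 1 f) p) (N2 p)"
definition b1 where "b1 p = ip (pd 1 (pd 2 f) p) (N1 p)"
definition b2 where "b2 p = ip (pd 1 (pd 2 f) p) (N2 p)"

text \<open>The inverse metric is \<open>diag (1 / E, - 1 / E)\<close>, so that zero mean curvature is the equality of the
  second fundamental form on \<open>(\<partial>\<^sub>u, \<partial>\<^sub>u)\<close> and \<open>(\<partial>\<^sub>v, \<partial>\<^sub>v)\<close>.\<close>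

lemma minimal_components:
  assumes p: "p \<in> D"
  shows "ip (pd 2 (pd 2 f) p) (N1 p) = a1 p" "ip (pd 2 (pd 2 f) p) (N2 p) = a2 p"
proof -
  have inv: "matrix_inv (induced_metric S f p) $ 1 $ 1 = inverse (E p)"
    "matrix_inv (induced_metric S f p) $ 2 $ 2 = - inverse (E p)"
    "matrix_inv (induced_metric S f p) $ 1 $ 2 = 0" "matrix_inv (induced_metric S f p) $ 2 $ 1 = 0"
    using matrix_inv_diag[of "induced_metric S f p"] frame_products[OF p]
    by (simp_all add: induced_metric_def)
  have "inverse (E p) *\<^sub>R (second_ff S L0 f 1 1 p - second_ff S L0 f 2 2 p) = 0"
    using minimal[OF p] by (simp add: mean_curvature_vector_def sum_2 inv scaleR_right_diff_distrib)
  then have "second_ff S L0 f 1 1 p = second_ff S L0 f 2 2 p" by simp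
  then have "ip (pd 1 (pd 1 f) p) z = ip (pd 2 (pd 2 f) p) z" if "z \<in> normal_space S L0 f p" for z
    using pinner_normal_part_cov_deriv[OF p that] unfolding second_ff_def by metis
  then show "ip (pd 2 (pd 2 f) p) (N1 p) = a1 p" "ip (pd 2 (pd 2 f) p) (N2 p) = a2 p"
    using normal_in[OF p] by (simp_all add: a1_def a2_def)
qed

lemma second_derivative_products:
  assumes p: "p \<in> D"
  shows "ip (pd 1 (pd 1 f) p) (pd 1 f p) = E p * pd 1 lam p"
    "ip (pd 1 (pd 1 f) p) (pd 2 f p) = - (E p * pd 2 lam p)"
    "ip (pd 1 (pd 2 f) p) (pd 1 f p) = E p * pd 2 lam p"
    "ip (pd 1 (pd 2 f) p) (pd 2 f p) = - (E p * pd 1 lam p)"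
    "ip (pd 2 (pd 2 f) p) (pd 1 f p) = E p * pd 1 lam p"
    "ip (pd 2 (pd 2 f) p) (pd 2 f p) = - (E p * pd 2 lam p)"
proof -
  note sym = pinner_commute[of S "pd 1 f p"] pinner_commute[of S "pd 2 f p"]
  note c = partials_commute(1)[OF p]
  have e11: "2 * ip (pd i (pd 1 f) p) (pd 1 f p) = 2 * E p * pd i lam p" for i
    using pd_ip_of_eq[OF p diff_frame(2) diff_frame(2) frame_products(1), of i] sym pd_E[OF p] by simp
  have e22: "2 * ip (pd i (pd 2 f) p) (pd 2 f p) = - (2 * E p * pd i lam p)" for i
    using pd_ip_of_eq[OF p diff_frame(2) diff_frame(2) frame_products(2), of i] sym pd_minus_E[OF p] by simp
  have e12: "ip (pd i (pd 1 f) p) (pd 2 f p) + ip (pd i (pd 2 f) p) (pd 1 f p) = 0" for i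
    using pd_ip_of_eq[OF p diff_frame(2) diff_frame(2) frame_products(3), of i] sym by simp
  show "ip (pd 1 (pd 1 f) p) (pd 1 f p) = E p * pd 1 lam p"
    "ip (pd 1 (pd 1 f) p) (pd 2 f p) = - (E p * pd 2 lam p)"
    "ip (pd 1 (pd 2 f) p) (pd 1 f p) = E p * pd 2 lam p"
    "ip (pd 1 (pd 2 f) p) (pd 2 f p) = - (E p * pd 1 lam p)"
    "ip (pd 2 (pd 2 f) p) (pd 1 f p) = E p * pd 1 lam p"
    "ip (pd 2 (pd 2 f) p) (pd 2 f p) = - (E p * pd 2 lam p)"
    using e11[of 1] e11[of 2] e22[of 1] e22[of 2] e12[of 1] e12[of 2] by (simp_all add: c)
qed

text \<open>The position vector is normal to the space form only if \<open>L\<^sub>0 \<noteq> 0\<close>. Its products are needed only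
  with the factor \<open>L\<^sub>0\<close>, and with that factor the formulas hold for all \<open>L\<^sub>0\<close>.\<close>

lemma second_derivative_position:
  assumes p: "p \<in> D"
  shows "L0 * ip (pd 1 (pd 1 f) p) (f p) = - (L0 * E p)"
    "L0 * ip (pd 2 (pd 2 f) p) (f p) = L0 * E p"
    "L0 * ip (pd 1 (pd 2 f) p) (f p) = 0"
proof -
  have "L0 = 0 \<or> ip (pd i (pd j f) p) (f p) + ip (pd j f p) (pd i f p) = 0" for i j
    using pd_ip_of_eq[OF p diff_frame(2) diff_frame(1) position_products(3), of i j] by fastforce
  from this[of 1 1] this[of 2 2] this[of 1 2]
  show "L0 * ip (pd 1 (pd 1 f) p) (f p) = - (L0 * E p)"
    "L0 * ip (pd 2 (pd 2 f) p) (f p) = L0 * E p"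
    "L0 * ip (pd 1 (pd 2 f) p) (f p) = 0"
    using frame_products(1-4)[OF p] by (auto simp: eq_neg_iff_add_eq_0 distrib_left[symmetric])
qed

lemma normal_derivative_products:
  assumes p: "p \<in> D"
  shows "ip (pd 1 N1 p) (pd 1 f p) = - a1 p" "ip (pd 1 N1 p) (pd 2 f p) = - b1 p"
    "ip (pd 2 N1 p) (pd 1 f p) = - b1 p" "ip (pd 2 N1 p) (pd 2 f p) = - a1 p"
    "ip (pd 1 N2 p) (pd 1 f p) = - a2 p" "ip (pd 1 N2 p) (pd 2 f p) = - b2 p"
    "ip (pd 2 N2 p) (pd 1 f p) = - b2 p" "ip (pd 2 N2 p) (pd 2 f p) = - a2 p"
proof -
  have "ip (pd i N1 p) (pd j f p) = - ip (pd i (pd j f) p) (N1 p)" for i j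
    using pd_ip_of_eq[OF p diff_frame(4) diff_frame(2) frame_products(9), of i j]
    by (simp add: pinner_commute[of S "N1 p"])
  then show "ip (pd 1 N1 p) (pd 1 f p) = - a1 p" "ip (pd 1 N1 p) (pd 2 f p) = - b1 p"
    "ip (pd 2 N1 p) (pd 1 f p) = - b1 p" "ip (pd 2 N1 p) (pd 2 f p) = - a1 p"
    using minimal_components[OF p] partials_commute(1)[OF p] by (simp_all add: a1_def b1_def)
  have "ip (pd i N2 p) (pd j f p) = - ip (pd i (pd j f) p) (N2 p)" for i j
    using pd_ip_of_eq[OF p diff_frame(5) diff_frame(2) frame_products(10), of i j]
    by (simp add: pinner_commute[of S "N2 p"])
  then show "ip (pd 1 N2 p) (pd 1 f p) = - a2 p" "ip (pd 1 N2 p) (pd 2 f p) = - b2 p"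
    "ip (pd 2 N2 p) (pd 1 f p) = - b2 p" "ip (pd 2 N2 p) (pd 2 f p) = - a2 p"
    using minimal_components[OF p] partials_commute(1)[OF p] by (simp_all add: a2_def b2_def)
qed

lemma normal_derivative_position:
  assumes p: "p \<in> D"
  shows "L0 * ip (pd i N1 p) (f p) = 0" "L0 * ip (pd i N2 p) (f p) = 0"
proof -
  have "L0 = 0 \<or> ip (pd i N1 p) (f p) + ip (N1 p) (pd i f p) = 0"
    using pd_ip_of_eq[OF p diff_frame(4) diff_frame(1) position_products(6), of i] by fastforce
  then show "L0 * ip (pd i N1 p) (f p) = 0" using frame_products[OF p] by auto
  have "L0 = 0 \<or> ip (pd i N2 p) (f p) + ip (N2 p) (pd i f p) = 0"
    using pd_ip_of_eq[OF p diff_frame(5) diff_frame(1) position_products(7), of i] by fastforce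
  then show "L0 * ip (pd i N2 p) (f p) = 0" using frame_products[OF p] by auto
qed

lemma parseval_normal_derivative:
  assumes p: "p \<in> D"
  shows "E p * ip x (pd i N1 p) = ip x (pd 1 f p) * ip (pd i N1 p) (pd 1 f p)
      - ip x (pd 2 f p) * ip (pd i N1 p) (pd 2 f p)
      + ip x (N1 p) * ip (pd i N1 p) (N1 p) - ip x (N2 p) * ip (pd i N1 p) (N2 p)"
    "E p * ip x (pd i N2 p) = ip x (pd 1 f p) * ip (pd i N2 p) (pd 1 f p)
      - ip x (pd 2 f p) * ip (pd i N2 p) (pd 2 f p)
      + ip x (N1 p) * ip (pd i N2 p) (N1 p) - ip x (N2 p) * ip (pd i N2 p) (N2 p)"
  using normal_derivative_position[OF p, of i] parseval[OF p, of x "pd i N1 p"]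
    parseval[OF p, of x "pd i N2 p"] by auto

lemma connection_products:
  assumes p: "p \<in> D"
  shows "ip (pd 1 N1 p) (N1 p) = E p * pd 1 lam p" "ip (pd 1 N1 p) (N2 p) = - (E p * \<mu>1 p)"
    "ip (pd 1 N2 p) (N1 p) = E p * \<mu>1 p" "ip (pd 1 N2 p) (N2 p) = - (E p * pd 1 lam p)"
    "ip (pd 2 N1 p) (N1 p) = E p * pd 2 lam p" "ip (pd 2 N1 p) (N2 p) = - (E p * \<mu>2 p)"
    "ip (pd 2 N2 p) (N1 p) = E p * \<mu>2 p" "ip (pd 2 N2 p) (N2 p) = - (E p * pd 2 lam p)"
proof -
  have c: "normal_conn S L0 f 1 N1 p = pd 1 lam p *\<^sub>R N1 p + \<mu>1 p *\<^sub>R N2 p"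
    "normal_conn S L0 f 1 N2 p = \<mu>1 p *\<^sub>R N1 p + pd 1 lam p *\<^sub>R N2 p"
    "normal_conn S L0 f 2 N1 p = pd 2 lam p *\<^sub>R N1 p + \<mu>2 p *\<^sub>R N2 p"
    "normal_conn S L0 f 2 N2 p = \<mu>2 p *\<^sub>R N1 p + pd 2 lam p *\<^sub>R N2 p"
    using conn p by (simp_all add: normal_conn_coeffs_def)
  have e: "ip (pd i X p) (N1 p) = ip (normal_conn S L0 f i X p) (N1 p)"
    "ip (pd i X p) (N2 p) = ip (normal_conn S L0 f i X p) (N2 p)" for i X
    using pinner_normal_part_cov_deriv[OF p] normal_in[OF p] by (simp_all add: normal_conn_def)
  show "ip (pd 1 N1 p) (N1 p) = E p * pd 1 lam p" "ip (pd 1 N1 p) (N2 p) = - (E p * \<mu>1 p)"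
    "ip (pd 1 N2 p) (N1 p) = E p * \<mu>1 p" "ip (pd 1 N2 p) (N2 p) = - (E p * pd 1 lam p)"
    "ip (pd 2 N1 p) (N1 p) = E p * pd 2 lam p" "ip (pd 2 N1 p) (N2 p) = - (E p * \<mu>2 p)"
    "ip (pd 2 N2 p) (N1 p) = E p * \<mu>2 p" "ip (pd 2 N2 p) (N2 p) = - (E p * pd 2 lam p)"
    unfolding e c using frame_products[OF p]
    by (simp_all add: pinner.add_left pinner.scaleR_left)
qed

text \<open>The difference \<open>\<langle>f\<^sub>u\<^sub>u, f\<^sub>v\<^sub>v\<rangle> - \<langle>f\<^sub>u\<^sub>v, f\<^sub>u\<^sub>v\<rangle> = \<partial>\<^sub>v \<langle>f\<^sub>u\<^sub>u, f\<^sub>v\<rangle> - \<partial>\<^sub>u \<langle>f\<^sub>u\<^sub>v, f\<^sub>v\<rangle>\<close> is computed in two ways,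
  from the metric, where \<open>K = L\<^sub>0\<close> determines \<open>\<lambda>\<^sub>u\<^sub>u - \<lambda>\<^sub>v\<^sub>v\<close>, and from the expansion in the basis.\<close>

lemma gauss_equation:
  assumes p: "p \<in> D"
  shows "a1 p * a1 p - a2 p * a2 p = b1 p * b1 p - b2 p * b2 p"
proof -
  note sp = second_derivative_products
  note pos = second_derivative_position[OF p]
  let ?lu = "pd 1 lam p" and ?lv = "pd 2 lam p"
  have dE: "pd i (\<lambda>q. - (E q * pd j lam q)) p = - (2 * E p * pd i lam p * pd j lam p + E p * pd i (pd j lam) p)"
    for i j
    using pd_minus[of "\<lambda>q. E q * pd j lam q" p i] pd_mult[of E p "pd j lam" i] pd_E[OF p, of i]
      diff_frame(10,11)[OF p] by (simp add: differentiable_exp)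
  have "ip (pd 2 (pd 1 (pd 1 f)) p) (pd 2 f p) + ip (pd 1 (pd 1 f) p) (pd 2 (pd 2 f) p)
      = - (2 * E p * ?lv * ?lv + E p * pd 2 (pd 2 lam) p)"
    using pd_ip_of_eq[OF p diff_frame(3) diff_frame(2) sp(2), of 2] dE by simp
  moreover have "ip (pd 1 (pd 1 (pd 2 f)) p) (pd 2 f p) + ip (pd 1 (pd 2 f) p) (pd 1 (pd 2 f) p)
      = - (2 * E p * ?lu * ?lu + E p * pd 1 (pd 1 lam) p)"
    using pd_ip_of_eq[OF p diff_frame(3) diff_frame(2) sp(4), of 1] dE by simp
  ultimately have A: "ip (pd 1 (pd 1 f) p) (pd 2 (pd 2 f) p) - ip (pd 1 (pd 2 f) p) (pd 1 (pd 2 f) p)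
      = E p * (2 * ?lu * ?lu - 2 * ?lv * ?lv + (pd 1 (pd 1 lam) p - pd 2 (pd 2 lam) p))"
    using third_partials_commute(1)[OF p] by (simp add: algebra_simps)
  have K: "pd 1 (pd 1 lam) p - pd 2 (pd 2 lam) p = - (L0 * E p)"
    using gauss_curvature_conformal[OF D_open p conf] curvature[OF p] by (simp add: field_simps)
  have P1: "E p * L0 * ip (pd 1 (pd 1 f) p) (f p) * ip (pd 2 (pd 2 f) p) (f p) = - (E p * (L0 * E p) * E p)"
  proof -
    have "E p * L0 * ip (pd 1 (pd 1 f) p) (f p) * ip (pd 2 (pd 2 f) p) (f p)
      = E p * (L0 * ip (pd 1 (pd 1 f) p) (f p)) * ip (pd 2 (pd 2 f) p) (f p)" by simp
    also have "\<dots> = - (E p * E p * (L0 * ip (pd 2 (pd 2 f) p) (f p)))" unfolding pos(1) by simp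
    finally show ?thesis unfolding pos(2) by simp
  qed
  have P2: "E p * L0 * ip (pd 1 (pd 2 f) p) (f p) * ip (pd 1 (pd 2 f) p) (f p) = 0"
    using pos(3) by auto
  have "E p * ip (pd 1 (pd 1 f) p) (pd 2 (pd 2 f) p)
    = E p * E p * (?lu * ?lu - ?lv * ?lv) + a1 p * a1 p - a2 p * a2 p - E p * (L0 * E p) * E p"
    unfolding parseval[OF p, of "pd 1 (pd 1 f) p"] P1 sp[OF p] minimal_components[OF p]
    by (simp add: a1_def a2_def algebra_simps)
  moreover have "E p * ip (pd 1 (pd 2 f) p) (pd 1 (pd 2 f) p)
    = E p * E p * (?lv * ?lv - ?lu * ?lu) + b1 p * b1 p - b2 p * b2 p"
    unfolding parseval[OF p, of "pd 1 (pd 2 f) p"] P2 sp[OF p]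
    by (simp add: b1_def b2_def algebra_simps)
  moreover have "E p * (ip (pd 1 (pd 1 f) p) (pd 2 (pd 2 f) p) - ip (pd 1 (pd 2 f) p) (pd 1 (pd 2 f) p))
    = E p * E p * (2 * ?lu * ?lu - 2 * ?lv * ?lv) - E p * (L0 * E p) * E p"
    unfolding A K by (simp add: algebra_simps)
  ultimately show ?thesis by (simp add: algebra_simps)
qed

lemma diff_coeffs:
  assumes "p \<in> D"
  shows "a1 differentiable (at p)" "a2 differentiable (at p)"
    "b1 differentiable (at p)" "b2 differentiable (at p)"
  using diff_frame[OF assms]
  by (auto simp: a1_def[abs_def] a2_def[abs_def] b1_def[abs_def] b2_def[abs_def] intro!: differentiable_pinner)

text \<open>Third derivatives of \<open>f\<close> commute, so that \<open>\<partial>\<^sub>v a\<^sub>i - \<partial>\<^sub>u b\<^sub>i = \<langle>f\<^sub>u\<^sub>u, \<partial>\<^sub>v N\<^sub>i\<rangle> - \<langle>f\<^sub>u\<^sub>v, \<partial>\<^sub>u N\<^sub>i\<rangle>\<close>. The other pair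
  of equations uses \<open>a\<^sub>i = \<langle>f\<^sub>v\<^sub>v, N\<^sub>i\<rangle>\<close>, that is minimality, and differentiates in the other
  direction.\<close>

lemma codazzi_equations:
  assumes p: "p \<in> D"
  shows "pd 2 a1 p - pd 1 b1 p
      = pd 2 lam p * a1 p - pd 1 lam p * b1 p + a2 p * \<mu>2 p - b2 p * \<mu>1 p"
    "pd 1 a1 p - pd 2 b1 p
      = pd 1 lam p * a1 p - pd 2 lam p * b1 p + a2 p * \<mu>1 p - b2 p * \<mu>2 p"
    "pd 2 a2 p - pd 1 b2 p
      = pd 2 lam p * a2 p - pd 1 lam p * b2 p + a1 p * \<mu>2 p - b1 p * \<mu>1 p"
    "pd 1 a2 p - pd 2 b2 p
      = pd 1 lam p * a2 p - pd 2 lam p * b2 p + a1 p * \<mu>1 p - b1 p * \<mu>2 p"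
proof -
  have g: "E p * (pd 2 a p - pd 1 b p) = E p * ip (pd 1 (pd 1 f) p) (pd 2 N p) - E p * ip (pd 1 (pd 2 f) p) (pd 1 N p)"
    "E p * (pd 1 a p - pd 2 b p) = E p * ip (pd 2 (pd 2 f) p) (pd 1 N p) - E p * ip (pd 1 (pd 2 f) p) (pd 2 N p)"
    if N: "\<And>q. q \<in> D \<Longrightarrow> N differentiable (at q)"
      and a: "\<And>q. q \<in> D \<Longrightarrow> ip (pd 1 (pd 1 f) q) (N q) = a q" "\<And>q. q \<in> D \<Longrightarrow> ip (pd 2 (pd 2 f) q) (N q) = a q"
      and b: "\<And>q. q \<in> D \<Longrightarrow> ip (pd 1 (pd 2 f) q) (N q) = b q" for N a b
    using pd_ip_of_eq[OF p diff_frame(3) N a(1), of 2, symmetric]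
      pd_ip_of_eq[OF p diff_frame(3) N a(2), of 1, symmetric]
      pd_ip_of_eq[OF p diff_frame(3) N b, of 1, symmetric]
      pd_ip_of_eq[OF p diff_frame(3) N b, of 2, symmetric]
    by (simp_all add: third_partials_commute[OF p] algebra_simps)
  note frame_simps = second_derivative_products[OF p] minimal_components[OF p]
    normal_derivative_products[OF p] connection_products[OF p]
    a1_def[of p, symmetric] a2_def[of p, symmetric] b1_def[of p, symmetric] b2_def[of p, symmetric]
  have cancel: "x = y" if "E p * x = E p * y" for x y using that by simp
  have g1: "E p * (pd 2 a1 p - pd 1 b1 p)
      = E p * ip (pd 1 (pd 1 f) p) (pd 2 N1 p) - E p * ip (pd 1 (pd 2 f) p) (pd 1 N1 p)"
    "E p * (pd 1 a1 p - pd 2 b1 p)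
      = E p * ip (pd 2 (pd 2 f) p) (pd 1 N1 p) - E p * ip (pd 1 (pd 2 f) p) (pd 2 N1 p)"
    by (rule g; simp add: diff_frame minimal_components a1_def[symmetric] b1_def[symmetric])+
  have g2: "E p * (pd 2 a2 p - pd 1 b2 p)
      = E p * ip (pd 1 (pd 1 f) p) (pd 2 N2 p) - E p * ip (pd 1 (pd 2 f) p) (pd 1 N2 p)"
    "E p * (pd 1 a2 p - pd 2 b2 p)
      = E p * ip (pd 2 (pd 2 f) p) (pd 1 N2 p) - E p * ip (pd 1 (pd 2 f) p) (pd 2 N2 p)"
    by (rule g; simp add: diff_frame minimal_components a2_def[symmetric] b2_def[symmetric])+
  show "pd 2 a1 p - pd 1 b1 p
      = pd 2 lam p * a1 p - pd 1 lam p * b1 p + a2 p * \<mu>2 p - b2 p * \<mu>1 p"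
    by (rule cancel, unfold g1(1) parseval_normal_derivative[OF p] frame_simps)
      (simp add: algebra_simps)
  show "pd 1 a1 p - pd 2 b1 p
      = pd 1 lam p * a1 p - pd 2 lam p * b1 p + a2 p * \<mu>1 p - b2 p * \<mu>2 p"
    by (rule cancel, unfold g1(2) parseval_normal_derivative[OF p] frame_simps)
      (simp add: algebra_simps)
  show "pd 2 a2 p - pd 1 b2 p
      = pd 2 lam p * a2 p - pd 1 lam p * b2 p + a1 p * \<mu>2 p - b1 p * \<mu>1 p"
    by (rule cancel, unfold g2(1) parseval_normal_derivative[OF p] frame_simps)
      (simp add: algebra_simps)
  show "pd 1 a2 p - pd 2 b2 p
      = pd 1 lam p * a2 p - pd 2 lam p * b2 p + a1 p * \<mu>1 p - b1 p * \<mu>2 p"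
    by (rule cancel, unfold g2(2) parseval_normal_derivative[OF p] frame_simps)
      (simp add: algebra_simps)
qed

text \<open>The mixed second derivatives of \<open>N\<^sub>1\<close> commute, so that
  \<open>\<partial>\<^sub>v \<langle>\<partial>\<^sub>u N\<^sub>1, N\<^sub>2\<rangle> - \<partial>\<^sub>u \<langle>\<partial>\<^sub>v N\<^sub>1, N\<^sub>2\<rangle> = \<langle>\<partial>\<^sub>u N\<^sub>1, \<partial>\<^sub>v N\<^sub>2\<rangle> - \<langle>\<partial>\<^sub>v N\<^sub>1, \<partial>\<^sub>u N\<^sub>2\<rangle>\<close>. On the right the tangential
  components give the commutator of the shape operators.\<close>

lemma ricci_equation:
  assumes p: "p \<in> D"
  shows "E p * E p * (pd 1 \<mu>2 p - pd 2 \<mu>1 p) = 2 * (a1 p * b2 p - a2 p * b1 p)"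
proof -
  let ?lu = "pd 1 lam p" and ?lv = "pd 2 lam p"
  have dE: "pd i (\<lambda>q. - (E q * m q)) p = - (2 * E p * pd i lam p * m p + E p * pd i m p)"
    if "m differentiable (at p)" for i m
    using pd_minus[of "\<lambda>q. E q * m q" p i] pd_mult[of E p m i] pd_E[OF p, of i]
      diff_frame(10)[OF p] that by (simp add: differentiable_exp)
  have "ip (pd 2 (pd 1 N1) p) (N2 p) + ip (pd 1 N1 p) (pd 2 N2 p)
      = - (2 * E p * ?lv * \<mu>1 p + E p * pd 2 \<mu>1 p)"
    using pd_ip_of_eq[OF p diff_frame(6) diff_frame(5) connection_products(2), of 2]
      dE[OF diff_frame(8)[OF p]] by simp
  moreover have "ip (pd 1 (pd 2 N1) p) (N2 p) + ip (pd 2 N1 p) (pd 1 N2 p)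
      = - (2 * E p * ?lu * \<mu>2 p + E p * pd 1 \<mu>2 p)"
    using pd_ip_of_eq[OF p diff_frame(6) diff_frame(5) connection_products(6), of 1]
      dE[OF diff_frame(9)[OF p]] by simp
  ultimately have "ip (pd 1 N1 p) (pd 2 N2 p) - ip (pd 2 N1 p) (pd 1 N2 p)
      = E p * (2 * ?lu * \<mu>2 p - 2 * ?lv * \<mu>1 p + (pd 1 \<mu>2 p - pd 2 \<mu>1 p))"
    using partials_commute(2)[OF p] by (simp add: algebra_simps)
  then have A: "E p * ip (pd 1 N1 p) (pd 2 N2 p) - E p * ip (pd 2 N1 p) (pd 1 N2 p)
      = E p * (E p * (2 * ?lu * \<mu>2 p - 2 * ?lv * \<mu>1 p + (pd 1 \<mu>2 p - pd 2 \<mu>1 p)))"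
    by (metis right_diff_distrib)
  show ?thesis
    using A unfolding parseval_normal_derivative[OF p] normal_derivative_products[OF p] connection_products[OF p]
    by (simp add: algebra_simps)
qed

lemma normal_connection_flat:
  assumes p: "p \<in> D"
  shows "pd 2 \<mu>1 p = pd 1 \<mu>2 p"
proof -
  \<comment> \<open>Null components of \<open>P\<close> (for \<open>s\<close>, \<open>t\<close>) and \<open>Q\<close> (for \<open>s'\<close>, \<open>t'\<close>).\<close>
  define s where "s q = a1 q + b1 q + (a2 q + b2 q)" for q
  define t where "t q = a1 q + b1 q - (a2 q + b2 q)" for q
  define s' where "s' q = a1 q - b1 q + (a2 q - b2 q)" for q
  define t' where "t' q = a1 q - b1 q - (a2 q - b2 q)" for q
  note defs = s_def t_def s'_def t'_def
  have orth: "s q * t' q + t q * s' q = 0" if "q \<in> D" for q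
    using gauss_equation[OF that] by (simp add: defs algebra_simps)
  have ricci: "2 * (E p * E p * (pd 1 \<mu>2 p - pd 2 \<mu>1 p)) = s p * t' p - t p * s' p"
    unfolding ricci_equation[OF p] by (simp add: defs algebra_simps)
  show ?thesis
  proof (cases "s p * t' p = 0")
    case True
    then have "2 * (E p * E p * (pd 1 \<mu>2 p - pd 2 \<mu>1 p)) = 0"
      using orth[OF p] unfolding ricci by linarith
    then show ?thesis by simp
  next
    case False
    \<comment> \<open>Sums and differences of the Codazzi equations are the equations for the null components. The
      frame has length \<open>e\<^bsup>\<lambda>\<^esup>\<close>, whence the scaling factors \<open>\<lambda>\<^sub>v \<plusminus> \<lambda>\<^sub>u\<close>.\<close>
    have pds: "pd i s q = pd i a1 q + pd i b1 q + (pd i a2 q + pd i b2 q)"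
      "pd i t q = pd i a1 q + pd i b1 q - (pd i a2 q + pd i b2 q)"
      "pd i s' q = pd i a1 q - pd i b1 q + (pd i a2 q - pd i b2 q)"
      "pd i t' q = pd i a1 q - pd i b1 q - (pd i a2 q - pd i b2 q)" if "q \<in> D" for i q
      using diff_coeffs[OF that] by (simp_all add: defs[abs_def] pd_add pd_diff)
    show ?thesis
    proof (rule closed_of_null_sections[OF D_open p smooth(3,4), of s t s' t'
          "\<lambda>q. pd 2 lam q - pd 1 lam q" "\<lambda>q. pd 2 lam q + pd 1 lam q"])
      fix q assume q: "q \<in> D"
      show "s differentiable (at q)" "t differentiable (at q)" "s' differentiable (at q)"
        "t' differentiable (at q)"
        using diff_coeffs[OF q] by (simp_all add: defs[abs_def])
      note cod = codazzi_equations[OF q]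
      show "pd 2 s q - pd 1 s q = (pd 2 lam q - pd 1 lam q + (\<mu>2 q - \<mu>1 q)) * s q"
        "pd 2 t q - pd 1 t q = (pd 2 lam q - pd 1 lam q - (\<mu>2 q - \<mu>1 q)) * t q"
        "pd 2 s' q + pd 1 s' q = (pd 2 lam q + pd 1 lam q + (\<mu>2 q + \<mu>1 q)) * s' q"
        "pd 2 t' q + pd 1 t' q = (pd 2 lam q + pd 1 lam q - (\<mu>2 q + \<mu>1 q)) * t' q"
        using cod unfolding pds[OF q] by (simp_all add: defs algebra_simps)
      show "s q * t' q + t q * s' q = 0" by (rule orth[OF q])
    qed (rule False)
  qed
qed

end

theorem proposition4p1:
  fixes S :: "'n::finite set" and L0 :: real
    and M :: "'m topology" and A :: "'m chart set" and F :: "'m \<Rightarrow> real^'n"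
    and w :: "'m chart" and D :: "(real^2) set"
    and lam \<mu>1 \<mu>2 :: "real^2 \<Rightarrow> real" and N1 N2 :: "real^2 \<Rightarrow> real^'n"
  assumes "neutral_ambient S L0"
    and "lorentz_surface M A"
    and "immersion_into M A (space_form S L0) F"
    and "conformal_timelike S A F"
    and "zero_mean_curvature S L0 A F"
    and "w \<in> A"
    and "conformal_exponent (chart_img w) (induced_metric S (in_chart F w)) lam"
    and "open D" and "D \<subseteq> chart_img w"
    and "normal_frame S L0 D (in_chart F w) lam N1 N2"
    and "normal_conn_coeffs S L0 D (in_chart F w) lam N1 N2 \<mu>1 \<mu>2"
    and "has_constant_curvature S A F L0"
  shows "\<forall>p\<in>D. pd 2 \<mu>1 p = pd 1 \<mu>2 p"
proof -
  have "minimal_surface_frame S L0 D (in_chart F w) N1 N2 lam \<mu>1 \<mu>2"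
  proof
    show "smooth_on D (in_chart F w)"
      using assms(3,6,9) smooth_on_subset unfolding immersion_into_def by blast
    show "in_chart F w p \<in> space_form S L0" if "p \<in> D" for p
    proof -
      have "chart_inv w p \<in> chart_dom w"
        using that assms(9) inv_into_into[of p "snd w" "fst w"]
        by (auto simp: chart_img_def chart_inv_def chart_dom_def)
      moreover have "chart_dom w \<subseteq> topspace M"
        using assms(2,6) unfolding lorentz_surface_def by blast
      ultimately show ?thesis
        using assms(3) unfolding immersion_into_def in_chart_def by auto
    qed
    show "conformal_exponent D (induced_metric S (in_chart F w)) lam"
      using assms(7,9) smooth_on_subset unfolding conformal_exponent_def by blast
    show "mean_curvature_vector S L0 (in_chart F w) p = 0" if "p \<in> D" for p
      using that assms(5,6,9) unfolding zero_mean_curvature_def by blast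
    show "gauss_curvature (induced_metric S (in_chart F w)) p = L0" if "p \<in> D" for p
      using that assms(6,9,12) unfolding has_constant_curvature_def by blast
  qed (use assms in auto)
  then show ?thesis using minimal_surface_frame.normal_connection_flat by blast
qed

end
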